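(* Let $h:[0,1]\to[0,1]$ be a concave function satisfying $h(t)\ge Ent(t)$ for all $0\le t\le1$. There exists a constant $K>0$ such that for every $n\ge1$ and every Borel measurable function $f:[0,1]^n\to\{0,1\}$ with $\mathbb{E}f=p$, $$p(1-p)\ \le\ K\sum_{i=1}^n\frac{I_f^h(i)}{\log\frac{4}{3I_f^h(i)}},$$ where a summand with $I_f^h(i)=0$ is interpreted as $0$.
   Context: $[0,1]^n$ carries the Lebesgue measure $\lambda$, and expectations are with respect to it. $\log$ is the logarithm to base 2. $Ent(t)=-t\log t-(1-t)\log(1-t)$ for $0<t<1$, with $Ent(0)=Ent(1)=0$. For $f:[0,1]^n\to\{0,1\}$, $x\in[0,1]^n$ and $1\le k\le n$, let $f_k^x:[0,1]\to\{0,1\}$ be the restriction of $f$ to the fiber through $x$ in direction $k$: $f_k^x(t)=f(x_1,\ldots,x_{k-1},t,x_{k+1},\ldots,x_n)$. For $h:[0,1]\to[0,1]$, the $h$-influence of the $k$-th coordinate on $f$ is $I_f^h(k)=\mathbb{E}_{x\in[0,1]^n}\,h(\mathbb{E}f_k^x)$, where $\mathbb{E}f_k^x=\int_0^1 f_k^x(t)\,dt$. *)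

theory Defs
  imports "HOL-Analysis.Analysis"
begin

definition Ent :: "real \<Rightarrow> real" where
  "Ent t = (if 0 < t \<and> t < 1 then - t * log 2 t - (1 - t) * log 2 (1 - t) else 0)"

definition unit_interval :: "real measure" where
  "unit_interval = restrict_space lborel {0..1}"

(* Points of the n-cube are the functions x in PiE {1..n} (\<lambda>_. {0..1}), with coordinates x 1, ..., x n.
   The measurable sets are the Borel sets; since the product is finite, the product sigma-algebra
   is the Borel sigma-algebra of the cube. *)
definition cube :: "nat \<Rightarrow> (nat \<Rightarrow> real) measure" where
  "cube n = (\<Pi>\<^sub>M i\<in>{1..n}. unit_interval)"

definition fiber :: "((nat \<Rightarrow> real) \<Rightarrow> real) \<Rightarrow> nat \<Rightarrow> (nat \<Rightarrow> real) \<Rightarrow> real \<Rightarrow> real" where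
  "fiber f k x = (\<lambda>t. f (x(k := t)))"

definition h_influence ::
  "nat \<Rightarrow> (real \<Rightarrow> real) \<Rightarrow> ((nat \<Rightarrow> real) \<Rightarrow> real) \<Rightarrow> nat \<Rightarrow> real" where
  "h_influence n h f k =
     (\<integral>x. h (\<integral>t. fiber f k x t \<partial>unit_interval) \<partial>cube n)"

end

theory Submission
  imports Defs
begin

text \<open>For \<open>h = Ent\<close> call the \<open>h\<close>-influence the entropy influence. The function
  \<open>t / log (4 / (3 t))\<close> increases on \<open>[0,1]\<close> and \<open>h \<ge> Ent\<close>, so it suffices to prove the inequality
  for entropy influences; the constant \<open>4 / ln 2\<close> then serves for every \<open>h\<close>.

  The engine is Talagrand's inequality for Boolean functions on \<open>{0,1}\<^sup>B\<close>, where \<open>I b\<close> is the probability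
  that flipping the bit \<open>b\<close> changes the value: the variance is at most \<open>2 \<Sum> I b / (2 - ln (I b))\<close>
  (\<open>talagrand\<close>). Reveal the bits in decreasing order of influence and let \<open>d i\<close> be the martingale
  increments, so that the variance is the sum of the \<open>V i = E (d i)\<^sup>2\<close>. The logarithmic Sobolev
  inequality for \<open>d i\<close>, together with \<open>E \<bar>d i\<bar> \<le> I i / 2\<close>, bounds \<open>V i\<close> by the Dirichlet energy
  of \<open>d i\<close> plus \<open>I i\<close>, divided by \<open>2 - ln (I i)\<close>. Only bits \<open>j\<close> revealed no later than \<open>i\<close> contribute to
  this energy, and for them \<open>1 / (2 - ln (I j))\<close> is at least as large; after exchanging the sums, the
  energies in direction \<open>j\<close> add up to exactly \<open>I j\<close>.

  To use this on a grid \<open>{0..<2^m}\<^sup>n\<close>, write each coordinate in binary. The \<open>m\<close> digits of one coordinate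
  may have large total influence when a fiber is an arbitrary set, but when every fiber is an initial
  segment of relative length \<open>q\<close> the total is at most \<open>2 Ent q\<close>, because
  \<open>Ent q \<ge> q + Ent (2 q) / 2\<close> is the recursion that the digits obey (\<open>threshold_total_gap\<close>). Sorting along
  one coordinate at a time makes all fibers initial segments. It preserves the mean, and it does not
  increase any entropy influence: sorting is a sequence of replacements of two sets by their union and
  intersection, and concavity of \<open>Ent\<close> makes the entropy of the density submodular
  (\<open>sum_submodular_sorted_le\<close>). The resulting inequality \<open>grid_inequality\<close> has a constant that does not
  depend on \<open>m\<close> or \<open>n\<close>.

  Finally, a measurable subset of the cube is approximated in measure by unions of dyadic cells. Mean and
  entropy influences are continuous under this approximation, and the inequality passes to the limit.\<close>

section \<open>Averages over coordinates\<close>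

text \<open>Averaging over a coordinate returns a function of all coordinates again, one that no longer depends on the
  averaged one. Averages are thus conditional expectations for the uniform distribution on \<open>{..<N}\<close>, and
  they can be iterated and commuted as operators. The case \<open>N = 2\<close> is the discrete cube, and
  \<open>N = 2 ^ m\<close> is the grid.\<close>
definition avg :: "nat \<Rightarrow> 'a \<Rightarrow> (('a \<Rightarrow> nat) \<Rightarrow> real) \<Rightarrow> ('a \<Rightarrow> nat) \<Rightarrow> real" where
  "avg N b F x = (\<Sum>t<N. F (x(b := t))) / real N"

definition mean :: "nat \<Rightarrow> 'a set \<Rightarrow> (('a \<Rightarrow> nat) \<Rightarrow> real) \<Rightarrow> ('a \<Rightarrow> nat) \<Rightarrow> real" where
  "mean N S F = Finite_Set.fold (avg N) F S"

lemma avg_commute: "avg N b (avg N c F) = avg N c (avg N b F)"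
proof (cases "b = c")
  case False
  show ?thesis
  proof
    fix x
    have "(\<Sum>t<N. \<Sum>s<N. F (x(b := t, c := s))) = (\<Sum>s<N. \<Sum>t<N. F (x(c := s, b := t)))"
      using False by (subst sum.swap) (simp add: fun_upd_twist)
    then show "avg N b (avg N c F) x = avg N c (avg N b F) x"
      by (simp add: avg_def sum_divide_distrib [symmetric])
  qed
qed simp

lemma mean_empty [simp]: "mean N {} F = F"
  by (simp add: mean_def)

lemma mean_insert:
  assumes "finite S" "b \<notin> S"
  shows "mean N (insert b S) F = avg N b (mean N S F)"
proof -
  interpret comp_fun_commute "avg N"
    by standard (auto simp: avg_commute)
  show ?thesis
    using assms by (simp add: mean_def fold_insert)
qed

lemma avg_mean: "finite S \<Longrightarrow> avg N b (mean N S F) = mean N S (avg N b F)"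
  by (induction S rule: finite_induct) (simp_all add: mean_insert avg_commute)

lemma avg_idem: "N > 0 \<Longrightarrow> avg N b (avg N b F) = avg N b F"
  by (rule ext) (simp add: avg_def)

lemma mean_avg:
  assumes "finite S" "b \<in> S" "N > 0"
  shows "mean N S (avg N b F) = mean N S F"
proof -
  obtain T where T: "S = insert b T" "b \<notin> T"
    using assms(2) by (meson mk_disjoint_insert)
  then have "finite T" using assms(1) by simp
  then show ?thesis
    using T assms(3) by (simp add: mean_insert avg_mean avg_idem)
qed

lemma mean_union:
  assumes "finite S" "finite T" "S \<inter> T = {}"
  shows "mean N (S \<union> T) F = mean N S (mean N T F)"
  using assms by (induction S rule: finite_induct) (simp_all add: mean_insert)

text \<open>The values that \<open>mean N S F x\<close> depends on are those at points that agree with \<open>x\<close> off \<open>S\<close> and have entries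
  below \<open>N\<close> on \<open>S\<close>. This matters because the functions involved are also defined at points whose entries
  are not below \<open>N\<close>, where the inequalities of interest can fail.\<close>
lemma mean_mono_on:
  assumes "finite S"
    and "\<And>y. (\<And>b. b \<in> S \<Longrightarrow> y b < N) \<Longrightarrow> (\<And>b. b \<notin> S \<Longrightarrow> y b = x b) \<Longrightarrow> F y \<le> G y"
  shows "mean N S F x \<le> mean N S G x"
  using assms
proof (induction S arbitrary: x rule: finite_induct)
  case (insert b S)
  have "mean N S F (x(b := t)) \<le> mean N S G (x(b := t))" if "t < N" for t
  proof (rule insert.IH)
    fix y :: "'a \<Rightarrow> nat"
    assume 1: "\<And>c. c \<in> S \<Longrightarrow> y c < N" and 2: "\<And>c. c \<notin> S \<Longrightarrow> y c = (x(b := t)) c"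
    show "F y \<le> G y"
    proof (rule insert.prems)
      show "y c < N" if "c \<in> insert b S" for c
        using that 1 2[OF insert.hyps(2)] \<open>t < N\<close> by auto
      show "y c = x c" if "c \<notin> insert b S" for c
        using that 2[of c] by auto
    qed
  qed
  then show ?case
    using insert.hyps by (auto simp: mean_insert avg_def intro!: divide_right_mono sum_mono)
qed auto

lemma mean_cong_on:
  assumes "finite S"
    and "\<And>y. (\<And>b. b \<in> S \<Longrightarrow> y b < N) \<Longrightarrow> (\<And>b. b \<notin> S \<Longrightarrow> y b = x b) \<Longrightarrow> F y = G y"
  shows "mean N S F x = mean N S G x"
  using assms by (intro antisym mean_mono_on) auto

lemma mean_mono: "finite S \<Longrightarrow> (\<And>y. F y \<le> G y) \<Longrightarrow> mean N S F x \<le> mean N S G x"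
  by (rule mean_mono_on)

lemma mean_add: "finite S \<Longrightarrow> mean N S (\<lambda>y. F y + G y) x = mean N S F x + mean N S G x"
  by (induction S arbitrary: x rule: finite_induct)
    (simp_all add: mean_insert avg_def sum.distrib add_divide_distrib)

lemma mean_diff: "finite S \<Longrightarrow> mean N S (\<lambda>y. F y - G y) x = mean N S F x - mean N S G x"
  by (induction S arbitrary: x rule: finite_induct)
    (simp_all add: mean_insert avg_def sum_subtractf diff_divide_distrib)

lemma mean_cmult: "finite S \<Longrightarrow> mean N S (\<lambda>y. c * F y) x = c * mean N S F x"
  by (induction S arbitrary: x rule: finite_induct)
    (simp_all add: mean_insert avg_def sum_distrib_left [symmetric])

lemma mean_const: "finite S \<Longrightarrow> N > 0 \<Longrightarrow> mean N S (\<lambda>y. c) x = c"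
  by (induction S arbitrary: x rule: finite_induct) (simp_all add: mean_insert avg_def)

lemma mean_sum:
  "finite S \<Longrightarrow> mean N S (\<lambda>y. \<Sum>i\<in>I. F i y) x = (\<Sum>i\<in>I. mean N S (F i) x)"
proof (induction I rule: infinite_finite_induct)
  case (infinite A)
  then show ?case using mean_cmult[of S N 0 "\<lambda>_. 0" x] by simp
next
  case empty
  then show ?case using mean_cmult[of S N 0 "\<lambda>_. 0" x] by simp
qed (simp_all add: mean_add)

lemma mean_nonneg: "finite S \<Longrightarrow> (\<And>y. 0 \<le> F y) \<Longrightarrow> 0 \<le> mean N S F x"
  using mean_mono[of S "\<lambda>_. 0" F N x] mean_cmult[of S N 0 "\<lambda>_. 0" x] by simp

lemma mean_upd:
  assumes "finite S" "b \<notin> S"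
  shows "mean N S F (x(b := t)) = mean N S (\<lambda>y. F (y(b := t))) x"
  using assms
proof (induction S arbitrary: x rule: finite_induct)
  case (insert c S)
  then have "b \<noteq> c" by auto
  have "mean N S F (x(b := t, c := s)) = mean N S (\<lambda>y. F (y(b := t))) (x(c := s))" for s
    unfolding fun_upd_twist[OF \<open>b \<noteq> c\<close>] using insert.prems by (intro insert.IH) simp
  then show ?case
    unfolding mean_insert[OF insert.hyps(1,2)] avg_def by simp
qed simp

lemma mean_self_upd:
  assumes "finite S" "b \<in> S" "N > 0"
  shows "mean N S F (x(b := t)) = mean N S F x"
proof -
  obtain T where T: "S = insert b T" "b \<notin> T"
    using assms(2) by (meson mk_disjoint_insert)
  then have "finite T" using assms(1) by simp
  then show ?thesis
    using T assms(3) by (simp add: mean_insert avg_def)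
qed

lemma mean_outside:
  assumes "finite S" "\<And>b. b \<notin> S \<Longrightarrow> x b = y b"
  shows "mean N S F x = mean N S F y"
  using assms
proof (induction S arbitrary: x y rule: finite_induct)
  case empty
  then have "x = y" by auto
  then show ?case by simp
next
  case (insert b S)
  have "mean N S F (x(b := t)) = mean N S F (y(b := t))" for t
    using insert.prems by (intro insert.IH) auto
  then show ?case using insert.hyps by (simp add: mean_insert avg_def)
qed

lemma mean_mean_subset:
  assumes "finite S" "T \<subseteq> S" "N > 0"
  shows "mean N S (mean N T F) = mean N S F"
proof -
  have "finite T" using assms finite_subset by blast
  then show ?thesis using assms(2)
    by (induction T rule: finite_induct) (simp_all add: mean_insert mean_avg assms)
qed

lemma abs_mean_le:
  assumes "finite S"
  shows "\<bar>mean N S F x\<bar> \<le> mean N S (\<lambda>y. \<bar>F y\<bar>) x"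
proof -
  have "mean N S F x \<le> mean N S (\<lambda>y. \<bar>F y\<bar>) x" "mean N S (\<lambda>y. -1 * F y) x \<le> mean N S (\<lambda>y. \<bar>F y\<bar>) x"
    using assms by (auto intro!: mean_mono)
  then show ?thesis unfolding mean_cmult[OF assms] by simp
qed

section \<open>The logarithmic Sobolev inequality on the discrete cube\<close>

definition gap :: "'a \<Rightarrow> (('a \<Rightarrow> nat) \<Rightarrow> real) \<Rightarrow> ('a \<Rightarrow> nat) \<Rightarrow> real" where
  "gap b F x = F (x(b := 1)) - F (x(b := 0))"

lemma avg_two: "avg 2 b F x = (F (x(b := 0)) + F (x(b := 1))) / 2"
  by (simp add: avg_def numeral_2_eq_2)

text \<open>The inequality \<open>ln x \<le> x - 1\<close> bounds entropy by variance over mean. For two points this is weaker than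
  the optimal logarithmic Sobolev inequality by a constant factor, but its right-hand side is
  homogeneous and jointly convex, which is what tensorization needs.\<close>
lemma two_point_entropy:
  fixes u v :: real
  assumes "u \<ge> 0" "v \<ge> 0"
  shows "(u * ln u + v * ln v) / 2 - (u + v) / 2 * ln ((u + v) / 2) \<le> (u - v)\<^sup>2 / (2 * (u + v))"
proof (cases "u + v = 0")
  case True
  with assms have "u = 0" "v = 0" by auto
  then show ?thesis by simp
next
  case False
  define m where "m = (u + v) / 2"
  have m: "m > 0" using False assms by (simp add: m_def)
  have bound: "w * ln w - w * ln m \<le> w * (w / m - 1)" if "w \<ge> 0" for w
  proof (cases "w = 0")
    case False
    then have "ln w - ln m = ln (w / m)" using that m by (simp add: ln_div)
    also have "\<dots> \<le> w / m - 1" using that False m by (intro ln_le_minus_one) simp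
    finally show ?thesis using that by (metis mult_left_mono right_diff_distrib)
  qed simp
  have "(u * ln u + v * ln v) / 2 - m * ln m
      = ((u * ln u - u * ln m) + (v * ln v - v * ln m)) / 2"
    by (simp add: m_def field_simps)
  also have "\<dots> \<le> (u * (u / m - 1) + v * (v / m - 1)) / 2"
    using bound[OF assms(1)] bound[OF assms(2)] by argo
  also have "\<dots> = (u - v)\<^sup>2 / (2 * (u + v))"
  proof -
    have "u * (u / m - 1) + v * (v / m - 1) = (u\<^sup>2 + v\<^sup>2 - m * (u + v)) / m"
      using m by (simp add: field_simps power2_eq_square)
    moreover have "u\<^sup>2 + v\<^sup>2 - m * (u + v) = (u - v)\<^sup>2 / 2"
      by (simp add: m_def field_simps power2_eq_square)
    moreover have "D / 2 / m / 2 = D / (2 * (u + v))" for D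
      by (simp add: m_def)
    ultimately show ?thesis by metis
  qed
  finally show ?thesis by (simp add: m_def)
qed

text \<open>The Cauchy-Schwarz inequality applied to \<open>(a - b) (a + b)\<close>: the right-hand side of
  \<open>two_point_entropy\<close>, evaluated at two mean squares, is at most the mean square of the difference.\<close>
lemma mean_square_gap:
  fixes a b :: "('a \<Rightarrow> nat) \<Rightarrow> real"
  fixes N x
  assumes S: "finite S"
  defines "u \<equiv> mean N S (\<lambda>y. (a y)\<^sup>2) x" and "v \<equiv> mean N S (\<lambda>y. (b y)\<^sup>2) x"
  shows "(u - v)\<^sup>2 / (2 * (u + v)) \<le> mean N S (\<lambda>y. (a y - b y)\<^sup>2) x"
proof (cases "u + v = 0")
  case True
  then show ?thesis using S by (simp add: mean_nonneg)
next
  case False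
  \<comment> \<open>The optimal multiplier in the linearized Cauchy-Schwarz inequality below.\<close>
  define l where "l = (u - v) / (u + v)"
  have uv: "u \<ge> 0" "v \<ge> 0" using S by (auto simp: u_def v_def mean_nonneg)
  have "l * ((a y)\<^sup>2 - (b y)\<^sup>2) \<le> (a y - b y)\<^sup>2 + l\<^sup>2 / 2 * ((a y)\<^sup>2 + (b y)\<^sup>2)" for y
  proof -
    have "0 \<le> ((a y - b y) - l / 2 * (a y + b y))\<^sup>2" "0 \<le> (l / 2 * (a y - b y))\<^sup>2" by simp_all
    then show ?thesis by (simp add: power2_eq_square field_simps)
  qed
  then have "mean N S (\<lambda>y. l * ((a y)\<^sup>2 - (b y)\<^sup>2)) x
      \<le> mean N S (\<lambda>y. (a y - b y)\<^sup>2 + l\<^sup>2 / 2 * ((a y)\<^sup>2 + (b y)\<^sup>2)) x"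
    by (intro mean_mono S)
  then have "l * (u - v) \<le> mean N S (\<lambda>y. (a y - b y)\<^sup>2) x + l\<^sup>2 / 2 * (u + v)"
    using S by (simp add: mean_add mean_diff mean_cmult u_def v_def del: times_divide_eq_left)
  moreover have "l * (u - v) - l\<^sup>2 / 2 * (u + v) = (u - v)\<^sup>2 / (2 * (u + v))"
  proof -
    have "l * (u + v) = u - v" using False by (simp add: l_def)
    then have "l\<^sup>2 / 2 * (u + v) = l * (u - v) / 2"
      by (metis (no_types, opaque_lifting) mult.assoc mult.commute power2_eq_square times_divide_eq_left)
    moreover have "(u - v)\<^sup>2 / (2 * (u + v)) = l * (u - v) / 2"
      by (simp add: l_def power2_eq_square)
    ultimately show ?thesis by simp
  qed
  ultimately show ?thesis by simp
qed

text \<open>Induction on the set of bits. Adding a bit \<open>b\<close> splits the entropy into the average of the two conditional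
  entropies, controlled by the induction hypothesis, and the two-point entropy of the two conditional mean
  squares, controlled by \<open>two_point_entropy\<close> and \<open>mean_square_gap\<close>.\<close>
theorem log_sobolev:
  assumes "finite S"
  shows "mean 2 S (\<lambda>y. (g y)\<^sup>2 * ln ((g y)\<^sup>2)) x
      - mean 2 S (\<lambda>y. (g y)\<^sup>2) x * ln (mean 2 S (\<lambda>y. (g y)\<^sup>2) x)
    \<le> (\<Sum>b\<in>S. mean 2 S (\<lambda>y. (gap b g y)\<^sup>2) x)"
  using assms
proof (induction S arbitrary: x rule: finite_induct)
  case (insert b S)
  define U where "U = mean 2 S (\<lambda>y. (g y)\<^sup>2)"
  define V where "V = mean 2 S (\<lambda>y. (g y)\<^sup>2 * ln ((g y)\<^sup>2))"
  define D where "D z = (\<Sum>c\<in>S. mean 2 S (\<lambda>y. (gap c g y)\<^sup>2) z)" for z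
  define z0 z1 where "z0 = x(b := 0)" and "z1 = x(b := 1)"
  have IH: "V z - U z * ln (U z) \<le> D z" for z
    using insert.IH[of z] by (simp add: U_def V_def D_def)
  have U0: "U z \<ge> 0" for z using insert.hyps by (simp add: U_def mean_nonneg)
  have split: "(U z1 - U z0)\<^sup>2 / (2 * (U z1 + U z0)) \<le> mean 2 S (\<lambda>y. (gap b g y)\<^sup>2) x"
    using mean_square_gap[OF insert.hyps(1), of 2 "\<lambda>y. g (y(b := 1))" x "\<lambda>y. g (y(b := 0))"]
      insert.hyps by (simp add: U_def z0_def z1_def mean_upd gap_def)
  have own: "mean 2 (insert b S) (\<lambda>y. (gap b g y)\<^sup>2) x = mean 2 S (\<lambda>y. (gap b g y)\<^sup>2) x"
  proof -
    have "gap b g (y(b := t)) = gap b g y" for y t by (simp add: gap_def)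
    then show ?thesis
      using insert.hyps by (simp add: mean_insert avg_two mean_upd)
  qed
  have "mean 2 (insert b S) (\<lambda>y. (g y)\<^sup>2 * ln ((g y)\<^sup>2)) x
      - mean 2 (insert b S) (\<lambda>y. (g y)\<^sup>2) x * ln (mean 2 (insert b S) (\<lambda>y. (g y)\<^sup>2) x)
      = (V z1 + V z0) / 2 - (U z1 + U z0) / 2 * ln ((U z1 + U z0) / 2)"
    using insert.hyps by (simp add: mean_insert avg_two U_def V_def z0_def z1_def add.commute)
  also have "\<dots> \<le> (D z1 + D z0) / 2 + (U z1 - U z0)\<^sup>2 / (2 * (U z1 + U z0))"
    using IH[of z1] IH[of z0] two_point_entropy[OF U0[of z1] U0[of z0]] by argo
  also have "(D z1 + D z0) / 2 = (\<Sum>c\<in>S. mean 2 (insert b S) (\<lambda>y. (gap c g y)\<^sup>2) x)"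
    using insert.hyps
    by (simp add: mean_insert avg_two D_def z0_def z1_def sum.distrib [symmetric]
        sum_divide_distrib add.commute)
  finally show ?case
    using insert.hyps split own by simp
qed simp

section \<open>Talagrand's inequality\<close>

lemma gap_mean_inside: "finite S \<Longrightarrow> b \<in> S \<Longrightarrow> gap b (mean 2 S F) = (\<lambda>_. 0)"
  by (simp add: gap_def mean_self_upd fun_eq_iff)

lemma gap_avg: "b \<noteq> c \<Longrightarrow> gap b (avg 2 c F) = avg 2 c (gap b F)"
  by (simp add: gap_def avg_two fun_eq_iff fun_upd_twist diff_divide_distrib add_divide_distrib)

text \<open>\<open>avg 2 b H\<close> is the orthogonal projection of \<open>H\<close> onto the functions that do not depend on \<open>b\<close>.\<close>
lemma mean_square_increment:
  assumes "finite S" "b \<in> S"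
  shows "mean 2 S (\<lambda>y. (H y - avg 2 b H y)\<^sup>2) x
    = mean 2 S (\<lambda>y. (H y)\<^sup>2) x - mean 2 S (\<lambda>y. (avg 2 b H y)\<^sup>2) x"
proof -
  have "avg 2 b (\<lambda>y. (H y - avg 2 b H y)\<^sup>2) = (\<lambda>z. avg 2 b (\<lambda>y. (H y)\<^sup>2) z - (avg 2 b H z)\<^sup>2)"
    by (rule ext) (simp add: avg_two power2_eq_square field_simps)
  then have "mean 2 S (avg 2 b (\<lambda>y. (H y - avg 2 b H y)\<^sup>2)) x
      = mean 2 S (avg 2 b (\<lambda>y. (H y)\<^sup>2)) x - mean 2 S (\<lambda>y. (avg 2 b H y)\<^sup>2) x"
    using assms(1) by (simp add: mean_diff)
  then show ?thesis using assms by (simp add: mean_avg)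
qed

lemma x_ln_x_tangent:
  assumes "t \<ge> 0" "m > (0::real)"
  shows "t * ln m + t - m \<le> t * ln t"
proof (cases "t = 0")
  case False
  then have t: "t > 0" using assms by simp
  have "ln (m / t) \<le> m / t - 1" using t assms by (intro ln_le_minus_one) simp
  then have "t * (ln m - ln t) \<le> t * (m / t - 1)"
    using t assms by (intro mult_left_mono) (simp_all add: ln_div)
  then show ?thesis using t by (simp add: algebra_simps)
qed (use assms in simp)

text \<open>The tangent at 1 gives \<open>\<bar>t\<bar> ln \<bar>t\<bar> \<ge> \<bar>t\<bar> - 1\<close>. This turns a small \<open>L\<^sup>1\<close> norm into a lower bound for
  the entropy of the square.\<close>
lemma square_ln_square_ge: "2 * t\<^sup>2 - 2 * \<bar>t\<bar> \<le> t\<^sup>2 * ln (t\<^sup>2)" for t :: real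
proof (cases "t = 0")
  case False
  define s where "s = \<bar>t\<bar>"
  have s: "s > 0" "s\<^sup>2 = t\<^sup>2" using False by (simp_all add: s_def)
  have "s * ln 1 + s - 1 \<le> s * ln s"
    using s by (intro x_ln_x_tangent) auto
  then have "2 * s * (s - 1) \<le> 2 * s * (s * ln s)" using s by (intro mult_left_mono) auto
  moreover have "ln (s\<^sup>2) = 2 * ln s" using s(1) by (simp add: ln_realpow)
  ultimately have "2 * s\<^sup>2 - 2 * s \<le> s\<^sup>2 * ln (s\<^sup>2)"
    by (simp add: algebra_simps power2_eq_square)
  then show ?thesis unfolding s(2) unfolding s_def .
qed simp

text \<open>Talagrand's inequality with an explicit constant. A summand with \<open>I b = 0\<close> vanishes, whatever value
  \<open>ln 0\<close> has.\<close>
theorem talagrand: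
  fixes f :: "('a \<Rightarrow> nat) \<Rightarrow> real"
  fixes x
  assumes S: "finite S" and f: "\<And>y. f y \<in> {0, 1}"
  defines "I \<equiv> \<lambda>b. mean 2 S (\<lambda>y. (gap b f y)\<^sup>2) x"
  shows "mean 2 S f x * (1 - mean 2 S f x) \<le> 2 * (\<Sum>b\<in>S. I b / (2 - ln (I b)))"
proof -
  define E where "E F = mean 2 S F x" for F
  have f01: "0 \<le> f y" "f y \<le> 1" "(f y)\<^sup>2 = f y" for y using f[of y] by auto
  have gap01: "(gap b f y)\<^sup>2 \<le> 1" for b y
    using f[of "y(b := 0)"] f[of "y(b := 1)"] by (auto simp: gap_def)
  have I0: "0 \<le> I b" and I1: "I b \<le> 1" for b
    using mean_mono[OF S, of "\<lambda>y. (gap b f y)\<^sup>2" "\<lambda>_. 1" 2 x] gap01 S by (auto simp: I_def mean_const mean_nonneg)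
  obtain bs0 where bs0: "set bs0 = S" "distinct bs0"
    using finite_distinct_list[OF S] by blast
  \<comment> \<open>Influences decrease along the list.\<close>
  define bs where "bs = sort_key (\<lambda>b. - I b) bs0"
  have bs: "set bs = S" "distinct bs" "sorted (map (\<lambda>b. - I b) bs)"
    using bs0 by (simp_all add: bs_def)
  define M where "M = length bs"
  define c where "c i = bs ! i" for i
  define a where "a i = I (c i)" for i
  have cS: "c i \<in> S" if "i < M" for i
    using that bs nth_mem by (auto simp: c_def M_def)
  have a01: "0 \<le> a i" "a i \<le> 1" for i by (simp_all add: a_def I0 I1)
  have a_dec: "a j \<le> a i" if "i \<le> j" "j < M" for i j
    using sorted_nth_mono[OF bs(3), of i j] that by (simp add: a_def c_def M_def)
  \<comment> \<open>\<open>T i\<close> are the bits not yet revealed at time \<open>i\<close>, and \<open>G i\<close> is the conditional expectation of \<open>f\<close>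
    given the others.\<close>
  define T where "T i = set (drop i bs)" for i
  have T: "T i \<subseteq> S" "finite (T i)" for i
    using bs(1) set_drop_subset[of i bs] by (auto simp: T_def)
  have T_Suc: "T i = insert (c i) (T (Suc i))" "c i \<notin> T (Suc i)" if "i < M" for i
  proof -
    have *: "drop i bs = c i # drop (Suc i) bs"
      using that by (simp add: Cons_nth_drop_Suc c_def M_def)
    show "T i = insert (c i) (T (Suc i))" by (simp add: T_def *)
    have "distinct (drop i bs)" using bs(2) by simp
    then show "c i \<notin> T (Suc i)" by (simp add: T_def *)
  qed
  have c_T: "c j \<in> T i" if "i \<le> j" "j < M" for i j
  proof -
    have "drop i bs ! (j - i) = c j" "j - i < length (drop i bs)"
      using that by (simp_all add: c_def M_def)
    then show ?thesis unfolding T_def by (metis nth_mem)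
  qed
  define G where "G i = mean 2 (T i) f" for i
  define d where "d i y = G (Suc i) y - G i y" for i y
  have G_step: "G i = avg 2 (c i) (G (Suc i))" if "i < M" for i
    using T_Suc[OF that] T(2) by (simp add: G_def mean_insert)
  have G_M: "G M = f" by (simp add: G_def T_def M_def)
  have G_0: "G 0 = mean 2 S f" using bs(1) by (simp add: G_def T_def)
  have G01: "0 \<le> G i y" "G i y \<le> 1" for i y
    using mean_mono[OF T(2)[of i], of f "\<lambda>_. 1" 2 y] T(2) f01
    by (auto simp: G_def mean_const mean_nonneg)
  have d_le: "\<bar>d i y\<bar> \<le> 1" for i y
    using G01[of i y] G01[of "Suc i" y] by (simp add: d_def)
  define V where "V i = E (\<lambda>y. (d i y)\<^sup>2)" for i
  define J where "J j i = E (\<lambda>y. (gap (c j) (d i) y)\<^sup>2)" for j i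
  have V0: "0 \<le> V i" and J0: "0 \<le> J j i" for i j
    using S by (simp_all add: V_def J_def E_def mean_nonneg)
  have V_sum: "(\<Sum>i<M. V i) = E f * (1 - E f)"
  proof -
    have "V i = E (\<lambda>y. (G (Suc i) y)\<^sup>2) - E (\<lambda>y. (G i y)\<^sup>2)" if "i < M" for i
      using mean_square_increment[OF S cS[OF that], of "G (Suc i)" x] G_step[OF that]
      by (simp add: V_def E_def d_def)
    then have "(\<Sum>i<M. V i) = E (\<lambda>y. (G M y)\<^sup>2) - E (\<lambda>y. (G 0 y)\<^sup>2)"
      using sum_lessThan_telescope[of "\<lambda>i. E (\<lambda>y. (G i y)\<^sup>2)" M] by simp
    also have "E (\<lambda>y. (G M y)\<^sup>2) = E f" by (simp add: G_M f01)
    also have "E (\<lambda>y. (G 0 y)\<^sup>2) = E (\<lambda>y. (E f)\<^sup>2)"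
      unfolding E_def G_0
    proof (rule mean_cong_on[OF S])
      fix y :: "'a \<Rightarrow> nat"
      assume "\<And>b. b \<notin> S \<Longrightarrow> y b = x b"
      then have "mean 2 S f y = mean 2 S f x" by (rule mean_outside[OF S])
      then show "(mean 2 S f y)\<^sup>2 = (mean 2 S f x)\<^sup>2" by simp
    qed
    also have "\<dots> = (E f)\<^sup>2" using S by (simp add: E_def mean_const)
    finally show ?thesis by (simp add: power2_eq_square algebra_simps)
  qed
  have J_sum: "(\<Sum>i<M. J j i) = a j" if j: "j < M" for j
  proof -
    define e where "e i = E (\<lambda>y. (gap (c j) (G i) y)\<^sup>2)" for i
    have "J j i = e (Suc i) - e i" if i: "i < M" for i
    proof (cases "j = i")
      case True
      then have "gap (c j) (G i) = (\<lambda>_. 0)"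
        unfolding G_def using c_T[of i j] T(2) i by (intro gap_mean_inside) auto
      moreover from this have "gap (c j) (d i) = gap (c j) (G (Suc i))"
        by (simp add: gap_def d_def fun_eq_iff)
      ultimately show ?thesis using S
        by (simp add: J_def e_def E_def mean_const)
    next
      case False
      then have ne: "c j \<noteq> c i"
        using bs(2) i j by (simp add: c_def M_def nth_eq_iff_index_eq)
      have g: "gap (c j) (G i) = avg 2 (c i) (gap (c j) (G (Suc i)))"
        unfolding G_step[OF i] using gap_avg[OF ne] .
      have "gap (c j) (d i) y = gap (c j) (G (Suc i)) y - avg 2 (c i) (gap (c j) (G (Suc i))) y" for y
        unfolding g [symmetric] by (simp add: gap_def d_def)
      then show ?thesis
        using mean_square_increment[OF S cS[OF i], of "gap (c j) (G (Suc i))" x]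
        by (simp add: J_def e_def E_def g)
    qed
    then have "(\<Sum>i<M. J j i) = e M - e 0" by (simp add: sum_lessThan_telescope)
    moreover have "gap (c j) (G 0) = (\<lambda>_. 0)"
      unfolding G_0 using S cS[OF j] by (rule gap_mean_inside)
    then have "e 0 = 0" using S by (simp add: e_def E_def mean_const)
    ultimately show ?thesis by (simp add: e_def G_M a_def I_def E_def)
  qed
  \<comment> \<open>The increment \<open>d i\<close> does not depend on bits revealed after time \<open>i\<close>.\<close>
  have J_zero: "J j i = 0" if "i < j" "j < M" for i j
  proof -
    have "gap (c j) (G i) = (\<lambda>_. 0)" "gap (c j) (G (Suc i)) = (\<lambda>_. 0)"
      unfolding G_def using c_T[of i j] c_T[of "Suc i" j] T(2) that
      by (auto intro!: gap_mean_inside)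
    then have "gap (c j) (d i) = (\<lambda>_. 0)" by (simp add: gap_def d_def fun_eq_iff)
    then show ?thesis using S by (simp add: J_def E_def mean_const)
  qed
  have sum_S: "(\<Sum>b\<in>S. F b) = (\<Sum>j<M. F (c j))" for F :: "'a \<Rightarrow> real"
    using sum.reindex_bij_betw[OF bij_betw_nth[OF bs(2) refl refl], of F] bs(1)
    by (simp add: c_def M_def)
  have L1: "E (\<lambda>y. \<bar>d i y\<bar>) \<le> a i / 2" if i: "i < M" for i
  proof -
    have "d i y = mean 2 (T (Suc i)) (\<lambda>z. f z - avg 2 (c i) f z) y" for y
      using T(2) by (simp add: d_def G_step[OF i] mean_diff) (simp add: G_def avg_mean)
    then have "E (\<lambda>y. \<bar>d i y\<bar>) \<le> E (mean 2 (T (Suc i)) (\<lambda>z. \<bar>f z - avg 2 (c i) f z\<bar>))"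
      unfolding E_def using abs_mean_le[OF T(2)] by (intro mean_mono S) simp
    also have "\<dots> = E (\<lambda>z. \<bar>f z - avg 2 (c i) f z\<bar>)"
      unfolding E_def using mean_mean_subset[OF S T(1)] by simp
    also have "\<dots> \<le> E (\<lambda>z. 1 / 2 * (gap (c i) f z)\<^sup>2)"
      unfolding E_def
    proof (rule mean_mono_on[OF S])
      fix y :: "'a \<Rightarrow> nat"
      \<comment> \<open>At points of the cube, \<open>f\<close> differs from its average over one bit by half the gap, and the gap of a Boolean
        function is 0 or \<open>\<plusminus>1\<close>.\<close>
      assume "\<And>b. b \<in> S \<Longrightarrow> y b < 2"
      then have "y (c i) = 0 \<or> y (c i) = 1" using cS[OF i] by force
      then have "f y = f (y(c i := 0)) \<or> f y = f (y(c i := 1))" by (metis fun_upd_triv)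
      then show "\<bar>f y - avg 2 (c i) f y\<bar> \<le> 1 / 2 * (gap (c i) f y)\<^sup>2"
        using f[of "y(c i := 0)"] f[of "y(c i := 1)"] by (auto simp: avg_two gap_def)
    qed
    also have "\<dots> = a i / 2"
      using mean_cmult[OF S, of 2 "1/2" "\<lambda>z. (gap (c i) f z)\<^sup>2" x] by (simp add: E_def a_def I_def)
    finally show ?thesis .
  qed
  have V_le_a: "V i \<le> a i / 2" if "i < M" for i
  proof -
    have "(d i y)\<^sup>2 \<le> \<bar>d i y\<bar>" for y
      using mult_left_mono[OF d_le[of i y], of "\<bar>d i y\<bar>"] by (simp add: power2_eq_square)
    then have "V i \<le> E (\<lambda>y. \<bar>d i y\<bar>)" unfolding V_def E_def by (intro mean_mono S)
    with L1[OF that] show ?thesis by simp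
  qed
  \<comment> \<open>With the default value \<open>ln 0 = 0\<close> the formula \<open>1 / (2 - ln (a i))\<close> would break monotonicity at
    \<open>a i = 0\<close>; there \<open>V i = 0\<close>, and the weight 0 will do.\<close>
  define w where "w i = (if a i = 0 then 0 else 1 / (2 - ln (a i)))" for i
  have w0: "0 \<le> w i" for i
  proof (cases "a i = 0")
    case False
    then have "ln (a i) \<le> 0" using a01[of i] by simp
    then show ?thesis by (simp add: w_def)
  qed (simp add: w_def)
  have w_dec: "w j \<le> w i" if "i \<le> j" "j < M" for i j
  proof (cases "a j = 0")
    case False
    then have "0 < a j" "a j \<le> a i" using a01 a_dec[OF that] by (auto simp: less_le)
    moreover from this have "ln (a j) \<le> ln (a i)" "ln (a i) \<le> 0" using a01[of i] by auto
    then have "1 / (2 - ln (a j)) \<le> 1 / (2 - ln (a i))" by (intro frac_le) linarith+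
    ultimately show ?thesis by (simp add: w_def)
  qed (use w0 in \<open>simp add: w_def\<close>)
  have V_le: "V i \<le> w i * ((\<Sum>j<M. J j i) + a i)" if i: "i < M" for i
  proof (cases "V i = 0")
    case True
    then show ?thesis using w0 a01 J0 by (simp add: sum_nonneg)
  next
    case False
    then have Vpos: "0 < V i" using V0[of i] by simp
    then have apos: "0 < a i" and "V i \<le> a i" using V_le_a[OF i] by auto
    then have lnV: "ln (V i) \<le> ln (a i)" "ln (a i) \<le> 0" using Vpos a01 by auto
    \<comment> \<open>The entropy of \<open>(d i)\<^sup>2\<close> is large, since \<open>V i \<le> a i\<close> and the \<open>L\<^sup>1\<close> norm is small, while the
      logarithmic Sobolev inequality bounds it by the energy.\<close>
    have "2 * V i - a i \<le> 2 * V i - 2 * E (\<lambda>y. \<bar>d i y\<bar>)" using L1[OF i] by simp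
    also have "\<dots> = E (\<lambda>y. 2 * (d i y)\<^sup>2 - 2 * \<bar>d i y\<bar>)"
      using S by (simp add: E_def V_def mean_diff mean_cmult)
    also have "\<dots> \<le> E (\<lambda>y. (d i y)\<^sup>2 * ln ((d i y)\<^sup>2))"
      unfolding E_def by (intro mean_mono S square_ln_square_ge)
    also have "\<dots> \<le> V i * ln (V i) + (\<Sum>j<M. J j i)"
      using log_sobolev[OF S, of "d i" x] by (simp add: E_def V_def J_def sum_S)
    also have "\<dots> \<le> V i * ln (a i) + (\<Sum>j<M. J j i)"
      using lnV Vpos by (simp add: mult_left_mono)
    finally have "V i * (2 - ln (a i)) \<le> (\<Sum>j<M. J j i) + a i"
      by (simp add: algebra_simps)
    then have "V i \<le> ((\<Sum>j<M. J j i) + a i) / (2 - ln (a i))"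
      using lnV by (simp add: pos_le_divide_eq)
    then show ?thesis using apos by (simp add: w_def)
  qed
  have "E f * (1 - E f) \<le> (\<Sum>i<M. w i * ((\<Sum>j<M. J j i) + a i))"
    unfolding V_sum [symmetric] by (intro sum_mono V_le) simp
  also have "\<dots> = (\<Sum>i<M. \<Sum>j<M. w i * J j i) + (\<Sum>i<M. w i * a i)"
    by (simp add: distrib_left sum.distrib sum_distrib_left)
  \<comment> \<open>Here the order of the bits is used: \<open>J j i \<noteq> 0\<close> forces \<open>j \<le> i\<close>, and then \<open>w i \<le> w j\<close>.\<close>
  also have "(\<Sum>i<M. \<Sum>j<M. w i * J j i) \<le> (\<Sum>i<M. \<Sum>j<M. w j * J j i)"
  proof (intro sum_mono)
    fix i j
    assume "i \<in> {..<M}" "j \<in> {..<M}"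
    then show "w i * J j i \<le> w j * J j i"
      using w_dec[of j i] J_zero[of i j] J0[of j i]
      by (cases "j \<le> i") (auto intro: mult_right_mono)
  qed
  also have "(\<Sum>i<M. \<Sum>j<M. w j * J j i) = (\<Sum>j<M. w j * a j)"
    by (subst sum.swap) (simp add: sum_distrib_left [symmetric] J_sum)
  also have "(\<Sum>j<M. w j * a j) = (\<Sum>b\<in>S. I b / (2 - ln (I b)))"
    unfolding sum_S by (intro sum.cong refl) (simp add: w_def a_def)
  finally show ?thesis by (simp add: E_def)
qed

section \<open>The binary entropy function\<close>

lemma convex_on_x_ln_x: "convex_on {0..} (\<lambda>t::real. t * ln t)"
proof (rule convex_onI)
  fix t x y :: real
  assume t: "0 < t" "t < 1" and xy: "x \<in> {0..}" "y \<in> {0..}"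
  define m where "m = (1 - t) * x + t * y"
  have m0: "(1 - t) * x \<ge> 0" "t * y \<ge> 0" using t xy by auto
  show "((1 - t) *\<^sub>R x + t *\<^sub>R y) * ln ((1 - t) *\<^sub>R x + t *\<^sub>R y) \<le> (1 - t) * (x * ln x) + t * (y * ln y)"
  proof (cases "m = 0")
    case True
    then have "x = 0" "y = 0" using m0 t by (auto simp: m_def add_nonneg_eq_0_iff)
    then show ?thesis by simp
  next
    case False
    then have m: "m > 0" using m0 by (simp add: m_def)
    have "(1 - t) * (x * ln m + x - m) \<le> (1 - t) * (x * ln x)"
      "t * (y * ln m + y - m) \<le> t * (y * ln y)"
      using x_ln_x_tangent[OF _ m] xy t by (auto intro!: mult_left_mono)
    moreover have "(1 - t) * (x * ln m + x - m) + t * (y * ln m + y - m) = m * ln m"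
      by (simp add: m_def algebra_simps)
    ultimately show ?thesis by (simp add: m_def)
  qed
qed simp

lemma Ent_eq: "0 \<le> t \<Longrightarrow> t \<le> 1 \<Longrightarrow> Ent t = - (t * ln t + (1 - t) * ln (1 - t)) / ln 2"
  by (cases "t = 0 \<or> t = 1") (auto simp: Ent_def log_def field_simps)

lemma Ent_0 [simp]: "Ent 0 = 0" and Ent_1 [simp]: "Ent 1 = 0"
  by (simp_all add: Ent_def)

lemma Ent_one_minus: "Ent (1 - t) = Ent t"
  by (auto simp: Ent_def algebra_simps)

lemma concave_on_Ent: "concave_on {0..1} Ent"
  unfolding concave_on_iff
proof (intro conjI ballI allI impI)
  fix x y u v :: real
  assume xy: "x \<in> {0..1}" "y \<in> {0..1}" and uv: "0 \<le> u" "0 \<le> v" "u + v = 1"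
  define \<eta> where "\<eta> t = t * ln t" for t :: real
  have *: "\<eta> (u * a + v * b) \<le> u * \<eta> a + v * \<eta> b" if "a \<ge> 0" "b \<ge> 0" for a b
    using convex_on_x_ln_x uv that unfolding convex_on_def \<eta>_def by simp
  have "u * (1 - x) + v * (1 - y) = 1 - (u * x + v * y)" using uv by (simp add: algebra_simps)
  then have c: "\<eta> (u * x + v * y) + \<eta> (1 - (u * x + v * y))
      \<le> u * (\<eta> x + \<eta> (1 - x)) + v * (\<eta> y + \<eta> (1 - y))"
    using *[of x y] *[of "1 - x" "1 - y"] xy by (simp add: algebra_simps)
  have E: "Ent t = - (\<eta> t + \<eta> (1 - t)) / ln 2" if "0 \<le> t" "t \<le> 1" for t
    using Ent_eq[OF that] by (simp add: \<eta>_def)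
  have "u * x + v * y \<le> 1"
    using convex_bound_le[of x 1 y u v] xy uv by simp
  then have "Ent (u * x + v * y) = - (\<eta> (u * x + v * y) + \<eta> (1 - (u * x + v * y))) / ln 2"
    using xy uv by (intro E) auto
  moreover have "u * Ent x + v * Ent y = - (u * (\<eta> x + \<eta> (1 - x)) + v * (\<eta> y + \<eta> (1 - y))) / ln 2"
    using xy by (simp add: E field_simps)
  ultimately show "u * Ent x + v * Ent y \<le> Ent (u *\<^sub>R x + v *\<^sub>R y)"
    using c by (simp add: divide_right_mono)
qed simp

lemma Ent_nonneg: "0 \<le> Ent t"
proof (cases "0 < t \<and> t < 1")
  case True
  then have "t * log 2 t \<le> 0" "(1 - t) * log 2 (1 - t) \<le> 0"
    by (auto intro!: mult_nonneg_nonpos)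
  then show ?thesis using True by (simp add: Ent_def)
qed (auto simp: Ent_def)

lemma Ent_le_1: 
  assumes "0 \<le> t" "t \<le> 1"
  shows "Ent t \<le> 1"
proof -
  have "ln (1/2) \<le> t * ln t - t * ln (1/2) + t * ln(1/2) + (1-t) * ln (1-t)"
    using x_ln_x_tangent[of t "1/2"] x_ln_x_tangent[of "1 - t" "1/2"] assms
    by (simp add: algebra_simps)
  then have "- (t * ln t + (1 - t) * ln (1 - t)) \<le> ln 2" by (simp add: ln_div)
  then show ?thesis using Ent_eq[OF assms] by simp
qed

text \<open>After multiplication by \<open>ln 2\<close>, the difference of the two sides is
  \<open>\<eta> (1 - 2 q) / 2 - \<eta> (1 - q)\<close> with \<open>\<eta> t = t ln t\<close>. It is nonnegative because \<open>\<eta>\<close> is convex, \<open>\<eta> 1 = 0\<close>,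
  and \<open>1 - q\<close> is the midpoint of \<open>1 - 2 q\<close> and 1.\<close>
lemma Ent_double:
  assumes "0 \<le> q" "q \<le> 1/2"
  shows "q + Ent (2 * q) / 2 \<le> Ent q"
proof (cases "q = 0")
  case False
  define \<eta> where "\<eta> t = t * ln t" for t :: real
  have "\<eta> (1/2 * (1 - 2 * q) + 1/2 * 1) \<le> 1/2 * \<eta> (1 - 2 * q) + 1/2 * \<eta> 1"
    using convex_onD[OF convex_on_x_ln_x, of "1/2" "1 - 2 * q" 1] assms
    by (simp add: \<eta>_def)
  then have c: "2 * \<eta> (1 - q) \<le> \<eta> (1 - 2 * q)" by (simp add: \<eta>_def algebra_simps)
  have "ln (2 * q) = ln 2 + ln q" using False assms by (simp add: ln_mult)
  then have "\<eta> (2 * q) = 2 * q * ln 2 + 2 * \<eta> q" by (simp add: \<eta>_def algebra_simps)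
  moreover have "Ent q = - (\<eta> q + \<eta> (1 - q)) / ln 2" "Ent (2 * q) = - (\<eta> (2 * q) + \<eta> (1 - 2 * q)) / ln 2"
    using assms by (simp_all add: Ent_eq \<eta>_def)
  ultimately have "(Ent q - q - Ent (2 * q) / 2) * ln 2 = (\<eta> (1 - 2 * q) - 2 * \<eta> (1 - q)) / 2"
    by (simp add: field_simps)
  also have "\<dots> \<ge> 0" using c by simp
  finally have "0 \<le> Ent q - q - Ent (2 * q) / 2"
    by (simp add: zero_le_mult_iff)
  then show ?thesis by simp
qed simp

section \<open>Influences of binary digits\<close>

text \<open>The bit \<open>(k, j)\<close> is the digit of weight \<open>2 ^ j\<close> of the coordinate \<open>k\<close>, so that \<open>val m\<close> maps a point of the
  discrete cube to a point of the grid.\<close>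
definition val :: "nat \<Rightarrow> ('k \<times> nat \<Rightarrow> nat) \<Rightarrow> 'k \<Rightarrow> nat" where
  "val m x k = (\<Sum>j<m. x (k, j) * 2 ^ j)"

lemma val_Suc: "val (Suc m) x k = val m x k + x (k, m) * 2 ^ m"
  by (simp add: val_def)

lemma val_upd_outside: "b \<notin> {k} \<times> {..<m} \<Longrightarrow> val m (x(b := t)) k = val m x k"
  unfolding val_def by (intro sum.cong) auto

lemma val_less: "(\<And>j. j < m \<Longrightarrow> x (k, j) < 2) \<Longrightarrow> val m x k < 2 ^ m"
proof (induction m)
  case (Suc m)
  have "x (k, m) \<le> 1" using Suc.prems[of m] by simp
  then have "x (k, m) * 2 ^ m \<le> 1 * 2 ^ m" by (rule mult_right_mono) simp
  moreover have "val m x k < 2 ^ m" using Suc by simp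
  ultimately have "val m x k + x (k, m) * 2 ^ m < 2 ^ m + 1 * 2 ^ m" by (intro add_less_le_mono)
  then show ?case by (simp add: val_Suc)
qed (simp add: val_def)

lemma block_Suc: "{k} \<times> {..<Suc m} = insert (k, m) ({k} \<times> {..<m})"
  by auto

lemma mean_block_Suc:
  "mean 2 ({k} \<times> {..<Suc m}) H x =
    (mean 2 ({k} \<times> {..<m}) (\<lambda>y. H (y((k, m) := 0))) x
     + mean 2 ({k} \<times> {..<m}) (\<lambda>y. H (y((k, m) := 1))) x) / 2"
  unfolding block_Suc by (subst mean_insert) (simp_all add: avg_two mean_upd del: fun_upd_apply)

lemma mean_block_val:
  "mean 2 ({k} \<times> {..<m}) (\<lambda>y. g (val m y k)) x = (\<Sum>t<2^m. g t) / 2 ^ m"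
proof (induction m arbitrary: g)
  case (Suc m)
  have "(\<Sum>t<2^Suc m. g t) = (\<Sum>t<2^m. g t) + (\<Sum>t<2^m. g (t + 2^m))"
    using sum.atLeastLessThan_concat[of 0 "2^m" "2^Suc m" g]
      sum.shift_bounds_nat_ivl[of g 0 "2^m" "2^m"]
    by (simp add: lessThan_atLeast0 mult_2)
  then show ?case
    using Suc[of g] Suc[of "\<lambda>v. g (v + 2 ^ m)"]
    by (simp add: mean_block_Suc val_Suc val_upd_outside add_divide_distrib)
qed (simp add: val_def)

text \<open>Split off the top digit. If \<open>s \<le> 2 ^ m\<close>, half of the range is constant and the other half carries the
  same threshold at the lower digits, while the top digit is pivotal at \<open>s\<close> of the \<open>2 ^ m\<close> values of the lower
  digits; if \<open>s \<ge> 2 ^ m\<close>, the situation is the mirror image. In both cases the recursion is the one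
  that \<open>Ent_double\<close> dominates. Truncated subtraction \<open>s - 2 ^ m\<close> and the minimum with \<open>2 ^ m\<close> let the two
  cases share one formula.\<close>
lemma threshold_total_gap:
  "(\<Sum>j<m. mean 2 ({k} \<times> {..<m}) (\<lambda>y. (gap (k, j) (\<lambda>z. of_bool (val m z k < s)) y)\<^sup>2) x)
    \<le> 2 * Ent (min (real s) (2 ^ m) / 2 ^ m)"
proof (induction m arbitrary: s)
  case 0
  show ?case by (simp add: Ent_nonneg)
next
  case (Suc m)
  define B where "B = {k} \<times> {..<m}"
  define D where "D s = (\<Sum>j<m. mean 2 B (\<lambda>y. (gap (k, j) (\<lambda>z. of_bool (val m z k < s)) y)\<^sup>2) x)" for s
  define H where "H j y = (gap (k, j) (\<lambda>z. of_bool (val (Suc m) z k < s)) y)\<^sup>2" for j y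
  have low: "mean 2 ({k} \<times> {..<Suc m}) (H j) x =
      (mean 2 B (\<lambda>y. (gap (k, j) (\<lambda>z. of_bool (val m z k < s)) y)\<^sup>2) x
       + mean 2 B (\<lambda>y. (gap (k, j) (\<lambda>z. of_bool (val m z k < s - 2 ^ m)) y)\<^sup>2) x) / 2"
    if "j < m" for j
  proof -
    have eq: "y((k, m) := t, (k, j) := b) = y((k, j) := b, (k, m) := t)" for y :: "_ \<Rightarrow> nat" and t b
      using that by (simp add: fun_upd_twist)
    have "val (Suc m) (y((k, m) := t, (k, j) := b)) k = val m (y((k, j) := b)) k + t * 2 ^ m" for y t b
      unfolding eq by (simp add: val_Suc val_upd_outside)
    then have "H j (y((k, m) := t)) = (gap (k, j) (\<lambda>z. of_bool (val m z k < s - t * 2 ^ m)) y)\<^sup>2" for y t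
      by (simp add: H_def gap_def less_diff_conv del: fun_upd_apply)
    then show ?thesis by (simp add: mean_block_Suc B_def)
  qed
  have H_top: "H m (y((k, m) := t)) = of_bool (val m y k < s \<and> s \<le> val m y k + 2 ^ m)" for y t
    by (auto simp: H_def gap_def val_Suc val_upd_outside)
  have T_Int: "{..<2 ^ m} \<inter> {t. t < s \<and> s \<le> t + 2 ^ m} = {t. t < 2 ^ m \<and> t < s \<and> s \<le> t + 2 ^ m}"
    by auto
  have top: "mean 2 ({k} \<times> {..<Suc m}) (H m) x
      = real (card {t. t < 2 ^ m \<and> t < s \<and> s \<le> t + 2 ^ m}) / 2 ^ m" (is "_ = real (card ?T) / _")
  proof -
    have "mean 2 ({k} \<times> {..<Suc m}) (H m) x
        = mean 2 ({k} \<times> {..<m}) (\<lambda>y. of_bool (val m y k < s \<and> s \<le> val m y k + 2 ^ m)) x"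
      unfolding mean_block_Suc H_top by simp
    also have "\<dots> = (\<Sum>t<2 ^ m. of_bool (t < s \<and> s \<le> t + 2 ^ m)) / 2 ^ m"
      by (rule mean_block_val)
    also have "(\<Sum>t<2 ^ m. of_bool (t < s \<and> s \<le> t + 2 ^ m)) = real (card ?T)"
      by (subst sum_of_bool_eq) (simp_all only: T_Int finite_lessThan)
    finally show ?thesis .
  qed
  have "(\<Sum>j<Suc m. mean 2 ({k} \<times> {..<Suc m}) (H j) x) = (D s + D (s - 2 ^ m)) / 2 + real (card ?T) / 2 ^ m"
    by (simp add: top low D_def sum.distrib sum_divide_distrib [symmetric])
  also have "\<dots> \<le> Ent (min (real s) (2 ^ m) / 2 ^ m) + Ent (min (real (s - 2 ^ m)) (2 ^ m) / 2 ^ m)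
      + real (card ?T) / 2 ^ m"
    using Suc[of s] Suc[of "s - 2 ^ m"] by (simp add: D_def B_def)
  also have "\<dots> \<le> 2 * Ent (min (real s) (2 ^ Suc m) / 2 ^ Suc m)"
  proof -
    consider "s \<le> 2 ^ m" | "2 ^ m < s" "s \<le> 2 ^ Suc m" | "2 ^ Suc m < s" by linarith
    then show ?thesis
    proof cases
      case 1
      then have s: "real s \<le> 2 ^ m" using of_nat_mono[OF 1, where ?'a = real] by simp
      define q where "q = real s / 2 ^ Suc m"
      have q: "0 \<le> q" "q \<le> 1 / 2" "real s / 2 ^ m = 2 * q" using s by (simp_all add: q_def)
      have "card ?T \<le> card {..<s}" by (intro card_mono) auto
      then have "real (card ?T) / 2 ^ m \<le> real s / 2 ^ m" by (simp add: divide_right_mono)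
      then have card: "real (card ?T) / 2 ^ m \<le> 2 * q" using q(3) by simp
      have "min (real s) (2 ^ m) / 2 ^ m = 2 * q" using s q(3) by (simp add: min_absorb1)
      moreover have "min (real s) (2 ^ Suc m) / 2 ^ Suc m = q"
      proof -
        have "real s \<le> 2 ^ Suc m" using s by (rule order_trans) simp
        then show ?thesis unfolding q_def by (simp only: min_absorb1)
      qed
      moreover have "min (real (s - 2 ^ m)) (2 ^ m) / 2 ^ m = (0::real)" using 1 by simp
      ultimately show ?thesis
        using card Ent_double[OF q(1,2)] by simp
    next
      case 2
      have s: "2 ^ m \<le> real s" "real s \<le> 2 ^ Suc m"
        using of_nat_mono[OF less_imp_le[OF 2(1)], where ?'a = real] of_nat_mono[OF 2(2), where ?'a = real]
        by simp_all
      define q where "q = 1 - real s / 2 ^ Suc m"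
      have q: "0 \<le> q" "q \<le> 1 / 2" using s by (simp_all add: q_def field_simps)
      have "?T \<subseteq> {s - 2 ^ m..<2 ^ m}" by auto
      then have "card ?T \<le> card {s - 2 ^ m..<2 ^ m}" by (intro card_mono) auto
      also have "\<dots> = 2 ^ Suc m - s" using 2 by simp
      finally have "real (card ?T) \<le> real (2 ^ Suc m - s)" by (simp only: of_nat_le_iff)
      also have "\<dots> = 2 ^ Suc m - real s" using 2(2) by (simp add: of_nat_diff)
      finally have "real (card ?T) \<le> 2 ^ Suc m - real s" .
      then have "real (card ?T) / 2 ^ m \<le> (2 ^ Suc m - real s) / 2 ^ m" by (simp add: divide_right_mono)
      also have "\<dots> = 2 * q" by (simp add: q_def field_simps)
      finally have card: "real (card ?T) / 2 ^ m \<le> 2 * q" .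
      have d: "real (s - 2 ^ m) = real s - 2 ^ m" using 2 by simp
      have "min (real (s - 2 ^ m)) (2 ^ m) / 2 ^ m = 1 - 2 * q"
        using s unfolding d by (simp add: q_def field_simps)
      moreover have "min (real s) (2 ^ Suc m) / 2 ^ Suc m = 1 - q"
        using s by (simp add: q_def)
      moreover have "min (real s) (2 ^ m) / 2 ^ m = 1" using s by simp
      ultimately show ?thesis
        using card Ent_double[OF q] by (simp add: Ent_one_minus)
    next
      case 3
      have s: "2 ^ Suc m \<le> real s"
        using of_nat_mono[OF less_imp_le[OF 3], where ?'a = real] by simp
      have "?T = {}" using 3 by auto
      moreover have "real (s - 2 ^ m) \<ge> 2 ^ m" using s 3 by simp
      moreover have "2 ^ m \<le> real s" by (rule order_trans[OF _ s]) simp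
      ultimately show ?thesis using s by (simp only: min_absorb2) simp
    qed
  qed
  finally show ?case unfolding H_def .
qed

lemma val_in_block:
  assumes "\<And>b. b \<notin> {k} \<times> {..<m} \<Longrightarrow> y b = x b"
  shows "val m y = (val m x)(k := val m y k)"
proof
  show "val m y i = ((val m x)(k := val m y k)) i" for i
    using assms by (cases "i = k") (auto simp: val_def)
qed

text \<open>Uniform independent digits make a uniform point of the grid.\<close>
lemma mean_val:
  assumes "finite S"
  shows "mean 2 (S \<times> {..<m}) (\<lambda>y. G (val m y)) x = mean (2 ^ m) S G (val m x)"
  using assms
proof (induction S arbitrary: x rule: finite_induct)
  case (insert k S)
  define H where "H = mean (2 ^ m) S G"
  have split: "insert k S \<times> {..<m} = {k} \<times> {..<m} \<union> S \<times> {..<m}" by auto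
  have "mean 2 (insert k S \<times> {..<m}) (\<lambda>y. G (val m y))
      = mean 2 ({k} \<times> {..<m}) (mean 2 (S \<times> {..<m}) (\<lambda>y. G (val m y)))"
    unfolding split using insert.hyps by (intro mean_union) auto
  then have "mean 2 (insert k S \<times> {..<m}) (\<lambda>y. G (val m y)) x
      = mean 2 ({k} \<times> {..<m}) (mean 2 (S \<times> {..<m}) (\<lambda>y. G (val m y))) x"
    by simp
  also have "mean 2 (S \<times> {..<m}) (\<lambda>y. G (val m y)) = (\<lambda>y. H (val m y))"
    using insert.IH by (simp add: H_def fun_eq_iff)
  also have "mean 2 ({k} \<times> {..<m}) (\<lambda>y. H (val m y)) x
      = mean 2 ({k} \<times> {..<m}) (\<lambda>y. H ((val m x)(k := val m y k))) x"
    using val_in_block by (intro mean_cong_on) (force intro: arg_cong[of _ _ H])+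
  also have "\<dots> = avg (2 ^ m) k H (val m x)"
    using mean_block_val[of k m "\<lambda>t. H ((val m x)(k := t))" x] by (simp add: avg_def)
  finally show ?case using insert.hyps by (simp add: H_def mean_insert)
qed simp

lemma avg_of_bool: "avg N k (\<lambda>y. of_bool (P y)) x = real (card {t. t < N \<and> P (x(k := t))}) / real N"
  by (simp add: avg_def Collect_conj_eq lessThan_def)

definition decreasing_along :: "nat \<Rightarrow> 'k \<Rightarrow> (('k \<Rightarrow> nat) \<Rightarrow> bool) \<Rightarrow> bool" where
  "decreasing_along N k P \<longleftrightarrow> (\<forall>x s t. s \<le> t \<longrightarrow> t < N \<longrightarrow> P (x(k := t)) \<longrightarrow> P (x(k := s)))"

lemma decreasing_initial_segment:
  assumes "decreasing_along N k P"
  shows "{t. t < N \<and> P (x(k := t))} = {..<card {t. t < N \<and> P (x(k := t))}}"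
proof -
  let ?A = "{t. t < N \<and> P (x(k := t))}"
  have down: "s \<in> ?A" if "t \<in> ?A" "s \<le> t" for s t
    using assms that unfolding decreasing_along_def by auto
  have fin: "finite ?A" by simp
  show ?thesis
  proof (intro set_eqI iffI)
    fix t assume "t \<in> ?A"
    then have "{..t} \<subseteq> ?A" using down by auto
    then have "card {..t} \<le> card ?A" using fin by (intro card_mono)
    then show "t \<in> {..<card ?A}" by simp
  next
    fix t assume t: "t \<in> {..<card ?A}"
    show "t \<in> ?A"
    proof (rule ccontr)
      assume "t \<notin> ?A"
      then have "?A \<subseteq> {..<t}" using down by (meson lessThan_iff not_le subsetI)
      then have "card ?A \<le> card {..<t}" by (intro card_mono) auto
      with t show False by simp
    qed
  qed
qed

text \<open>On the line through a grid point in direction \<open>k\<close>, a set that is decreasing in this direction is an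
  initial segment, so that \<open>threshold_total_gap\<close> applies.\<close>
lemma block_total_gap:
  assumes dec: "decreasing_along (2 ^ m) k P"
  shows "(\<Sum>j<m. mean 2 ({k} \<times> {..<m}) (\<lambda>y. (gap (k, j) (\<lambda>z. of_bool (P (val m z))) y)\<^sup>2) x)
    \<le> 2 * Ent (avg (2 ^ m) k (\<lambda>y. of_bool (P y)) (val m x))"
proof -
  define c where "c = card {t. t < 2 ^ m \<and> P ((val m x)(k := t))}"
  have c: "{t. t < 2 ^ m \<and> P ((val m x)(k := t))} = {..<c}"
    unfolding c_def by (rule decreasing_initial_segment[OF dec])
  have "card {t. t < 2 ^ m \<and> P ((val m x)(k := t))} \<le> card {..<2 ^ m :: nat}"
    by (intro card_mono) auto
  then have "c \<le> 2 ^ m" by (simp add: c_def)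
  from of_nat_mono[OF this, where ?'a = real] have c_le: "real c \<le> 2 ^ m" by simp
  have P: "P (val m z) \<longleftrightarrow> val m z k < c"
    if "\<And>b. b \<in> {k} \<times> {..<m} \<Longrightarrow> z b < 2" "\<And>b. b \<notin> {k} \<times> {..<m} \<Longrightarrow> z b = x b" for z
  proof -
    have "val m z k < 2 ^ m" using that(1) by (intro val_less) auto
    moreover have "val m z = (val m x)(k := val m z k)" using that(2) by (rule val_in_block)
    ultimately show ?thesis using c by (metis (mono_tags, lifting) lessThan_iff mem_Collect_eq)
  qed
  have "mean 2 ({k} \<times> {..<m}) (\<lambda>y. (gap (k, j) (\<lambda>z. of_bool (P (val m z))) y)\<^sup>2) x
      = mean 2 ({k} \<times> {..<m}) (\<lambda>y. (gap (k, j) (\<lambda>z. of_bool (val m z k < c)) y)\<^sup>2) x"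
    if "j < m" for j
  proof (rule mean_cong_on)
    fix y :: "_ \<Rightarrow> nat"
    assume y: "\<And>b. b \<in> {k} \<times> {..<m} \<Longrightarrow> y b < 2" "\<And>b. b \<notin> {k} \<times> {..<m} \<Longrightarrow> y b = x b"
    have "P (val m (y((k, j) := t))) \<longleftrightarrow> val m (y((k, j) := t)) k < c" if "t < 2" for t
      using y that \<open>j < m\<close> by (intro P) auto
    then show "(gap (k, j) (\<lambda>z. of_bool (P (val m z))) y)\<^sup>2
        = ((gap (k, j) (\<lambda>z. of_bool (val m z k < c)) y)\<^sup>2 :: real)"
      by (simp add: gap_def del: fun_upd_apply)
  qed simp
  then have "(\<Sum>j<m. mean 2 ({k} \<times> {..<m}) (\<lambda>y. (gap (k, j) (\<lambda>z. of_bool (P (val m z))) y)\<^sup>2) x)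
      = (\<Sum>j<m. mean 2 ({k} \<times> {..<m}) (\<lambda>y. (gap (k, j) (\<lambda>z. of_bool (val m z k < c)) y)\<^sup>2) x)"
    by (intro sum.cong) auto
  also have "\<dots> \<le> 2 * Ent (min (real c) (2 ^ m) / 2 ^ m)" by (rule threshold_total_gap)
  also have "min (real c) (2 ^ m) / 2 ^ m = avg (2 ^ m) k (\<lambda>y. of_bool (P y)) (val m x)"
    using c_le by (simp add: avg_of_bool c_def)
  finally show ?thesis .
qed

section \<open>Monotone rearrangement\<close>

text \<open>The sets on the left are the sorted version of the family \<open>A\<close>: they decrease, and each point lies in as
  many of them as before. The proof is insertion sort. The new set passes through the sorted chain from the
  top, and at each stage a set of the chain and the passing set are replaced by their union, which stays, and
  their intersection, which moves on.\<close>
lemma sum_submodular_sorted_le: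
  fixes \<Phi> :: "'u set \<Rightarrow> real"
  assumes sub: "\<And>X Y. \<Phi> (X \<union> Y) + \<Phi> (X \<inter> Y) \<le> \<Phi> X + \<Phi> Y"
  shows "(\<Sum>t<N. \<Phi> {u. t < card {s. s < N \<and> u \<in> A s}}) \<le> (\<Sum>t<N. \<Phi> (A t))"
proof (induction N)
  case (Suc N)
  define c where "c u = card {s. s < N \<and> u \<in> A s}" for u
  define L where "L t = {u. t < c u}" for t
  \<comment> \<open>\<open>L t\<close> is the sorted chain of the first \<open>N\<close> sets, and \<open>X t\<close> is what is left of \<open>A N\<close> when it reaches \<open>L t\<close>.\<close>
  define X where "X t = {u \<in> A N. t \<le> c u}" for t
  have c_le: "c u \<le> N" for u
    using card_mono[of "{..<N}" "{s. s < N \<and> u \<in> A s}"] by (auto simp: c_def)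
  have c_Suc: "card {s. s < Suc N \<and> u \<in> A s} = c u + of_bool (u \<in> A N)" for u
  proof -
    have "{s. s < Suc N \<and> u \<in> A s} = (if u \<in> A N then insert N {s. s < N \<and> u \<in> A s} else {s. s < N \<and> u \<in> A s})"
      by (auto simp: less_Suc_eq)
    then show ?thesis by (simp add: c_def)
  qed
  have L': "{u. t < card {s. s < Suc N \<and> u \<in> A s}} = L t \<union> X t" for t
    by (auto simp: c_Suc L_def X_def)
  have LX: "L t \<inter> X t = X (Suc t)" for t
    by (auto simp: L_def X_def)
  have "L N = {}" using c_le by (auto simp: L_def not_less)
  moreover have "X 0 = A N" by (simp add: X_def)
  moreover have "(\<Sum>t<N. \<Phi> (L t \<union> X t)) \<le> (\<Sum>t<N. \<Phi> (L t) - (\<Phi> (X (Suc t)) - \<Phi> (X t)))"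
  proof (rule sum_mono)
    show "\<Phi> (L t \<union> X t) \<le> \<Phi> (L t) - (\<Phi> (X (Suc t)) - \<Phi> (X t))" for t
      using sub[of "L t" "X t"] by (simp add: LX)
  qed
  moreover have "(\<Sum>t<N. \<Phi> (X (Suc t)) - \<Phi> (X t)) = \<Phi> (X N) - \<Phi> (X 0)"
    by (rule sum_lessThan_telescope)
  moreover have "(\<Sum>t<N. \<Phi> (L t)) \<le> (\<Sum>t<N. \<Phi> (A t))"
    using Suc.IH by (simp add: L_def c_def)
  ultimately show ?case
    unfolding L' by (simp add: sum_subtractf)
qed simp

lemma concave_on_exchange:
  fixes \<phi> :: "real \<Rightarrow> real"
  assumes "concave_on S \<phi>" "a \<in> S" "d \<in> S" "a \<le> b" "a \<le> c" "a + d = b + c"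
  shows "\<phi> a + \<phi> d \<le> \<phi> b + \<phi> c"
proof (cases "a = d")
  case True
  then have "b = a" "c = a" using assms by auto
  then show ?thesis using True by simp
next
  case False
  define t where "t = (b - a) / (d - a)"
  have t: "0 \<le> t" "t \<le> 1" using assms False by (auto simp: t_def field_simps)
  have td: "t * (d - a) = b - a" using False by (simp add: t_def)
  have b: "b = (1 - t) *\<^sub>R a + t *\<^sub>R d" and c: "c = (1 - t) *\<^sub>R d + t *\<^sub>R a"
    using td assms(6) by (simp_all add: algebra_simps)
  have "(1 - t) * \<phi> a + t * \<phi> d \<le> \<phi> b"
    unfolding b using assms t by (intro concave_onD) auto
  moreover have "(1 - t) * \<phi> d + t * \<phi> a \<le> \<phi> c"
    unfolding c using assms t by (intro concave_onD) auto
  ultimately show ?thesis by (simp add: algebra_simps)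
qed

text \<open>Every fiber in direction \<open>k\<close> is replaced by the initial segment with the same number of points.\<close>
definition sort_along :: "nat \<Rightarrow> 'k \<Rightarrow> (('k \<Rightarrow> nat) \<Rightarrow> bool) \<Rightarrow> ('k \<Rightarrow> nat) \<Rightarrow> bool" where
  "sort_along N k P x \<longleftrightarrow> x k < card {t. t < N \<and> P (x(k := t))}"

abbreviation ind :: "('b \<Rightarrow> bool) \<Rightarrow> 'b \<Rightarrow> real" where
  "ind P \<equiv> \<lambda>y. of_bool (P y)"

text \<open>The base point \<open>\<lambda>_. 0\<close> fixes the coordinates outside \<open>S\<close>.\<close>
definition ent_influence :: "nat \<Rightarrow> 'k set \<Rightarrow> (('k \<Rightarrow> nat) \<Rightarrow> bool) \<Rightarrow> 'k \<Rightarrow> real" where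
  "ent_influence N S P k = mean N S (\<lambda>y. Ent (avg N k (ind P) y)) (\<lambda>_. 0)"

lemma card_below_le: "card {t. t < N \<and> Q t} \<le> N"
  using card_mono[of "{..<N}" "{t. t < N \<and> Q t}"] by auto

lemma avg_ind_01: "0 \<le> avg N k (ind P) x" "avg N k (ind P) x \<le> 1"
  using card_below_le[of N "\<lambda>t. P (x(k := t))"] by (auto simp: avg_of_bool divide_le_eq)

lemma decreasing_sort_along: "decreasing_along N k (sort_along N k P)"
  by (auto simp: decreasing_along_def sort_along_def)

text \<open>Sorting in one direction keeps what was achieved in the others: the length of the sorted fiber is a
  count that is monotone in every direction in which the set was decreasing.\<close>
lemma decreasing_sort_along_other:
  assumes "decreasing_along N j P"
  shows "decreasing_along N j (sort_along N k P)"
proof (cases "j = k")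
  case False
  show ?thesis
    unfolding decreasing_along_def
  proof (intro allI impI)
    fix x :: "'a \<Rightarrow> nat" and s t
    assume st: "s \<le> t" "t < N" and P: "sort_along N k P (x(j := t))"
    have "{u. u < N \<and> P (x(j := t, k := u))} \<subseteq> {u. u < N \<and> P (x(j := s, k := u))}"
      using assms st unfolding fun_upd_twist[OF False] decreasing_along_def by blast
    then have "card {u. u < N \<and> P (x(j := t, k := u))} \<le> card {u. u < N \<and> P (x(j := s, k := u))}"
      by (intro card_mono) auto
    with P False show "sort_along N k P (x(j := s))" by (simp add: sort_along_def)
  qed
qed (simp add: decreasing_sort_along)

lemma avg_sort_along: "avg N k (ind (sort_along N k P)) = avg N k (ind P)"
proof
  fix x
  have "{t. t < N \<and> t < card {t. t < N \<and> P (x(k := t))}} = {..<card {t. t < N \<and> P (x(k := t))}}"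
    using card_below_le[of N "\<lambda>t. P (x(k := t))"] by auto
  then show "avg N k (ind (sort_along N k P)) x = avg N k (ind P) x"
    by (simp add: avg_of_bool sort_along_def)
qed

text \<open>In the plane spanned by the directions \<open>j\<close> and \<open>k\<close>, regard a two-dimensional section as a family of subsets
  of the \<open>j\<close>-axis, indexed by the \<open>k\<close>-axis. Sorting along \<open>k\<close> sorts this family, and the entropy of the
  density is a submodular function of a subset of the \<open>j\<close>-axis.\<close>
lemma avg_Ent_sort_along:
  assumes "j \<noteq> k"
  shows "avg N k (\<lambda>y. Ent (avg N j (ind (sort_along N k P)) y)) x
    \<le> avg N k (\<lambda>y. Ent (avg N j (ind P) y)) x"
proof -
  define A where "A t = {u. P (x(k := t, j := u))}" for t
  define \<Phi> where "\<Phi> X = Ent (real (card ({..<N} \<inter> X)) / real N)" for X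
  have sub: "\<Phi> (X \<union> Y) + \<Phi> (X \<inter> Y) \<le> \<Phi> X + \<Phi> Y" for X Y
  proof -
    let ?c = "\<lambda>X. real (card ({..<N} \<inter> X)) / real N"
    have m: "?c X \<le> ?c Y" if "X \<subseteq> Y" for X Y
      using that by (intro divide_right_mono of_nat_mono card_mono) auto
    have r: "?c X \<in> {0..1}" for X
      using card_mono[of "{..<N}" "{..<N} \<inter> X"] by (auto simp: divide_le_eq)
    have e: "({..<N} \<inter> X) \<union> ({..<N} \<inter> Y) = {..<N} \<inter> (X \<union> Y)"
      "({..<N} \<inter> X) \<inter> ({..<N} \<inter> Y) = {..<N} \<inter> (X \<inter> Y)" by auto
    have "card ({..<N} \<inter> X) + card ({..<N} \<inter> Y)
        = card ({..<N} \<inter> (X \<union> Y)) + card ({..<N} \<inter> (X \<inter> Y))"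
      using card_Un_Int[of "{..<N} \<inter> X" "{..<N} \<inter> Y"] unfolding e by simp
    then have "?c (X \<inter> Y) + ?c (X \<union> Y) = ?c X + ?c Y"
      by (simp add: add_divide_distrib [symmetric] of_nat_add [symmetric] add.commute del: of_nat_add)
    then have "Ent (?c (X \<inter> Y)) + Ent (?c (X \<union> Y)) \<le> Ent (?c X) + Ent (?c Y)"
      using r m by (intro concave_on_exchange[OF concave_on_Ent]) auto
    then show ?thesis by (simp add: \<Phi>_def)
  qed
  have count: "Ent (avg N j (ind Q) (x(k := t))) = \<Phi> {u. Q (x(k := t, j := u))}" for Q t
    by (simp add: avg_of_bool \<Phi>_def lessThan_def Collect_conj_eq)
  have sorted: "{u. sort_along N k P (x(k := t, j := u))} = {u. t < card {s. s < N \<and> u \<in> A s}}" for t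
  proof -
    have eq: "x(k := t, j := u, k := s) = x(k := s, j := u)" for u s
      using assms by (auto simp: fun_eq_iff)
    show ?thesis
      unfolding sort_along_def eq A_def using assms by simp
  qed
  show ?thesis
    using sum_submodular_sorted_le[of \<Phi> N A, OF sub]
    by (simp add: avg_def[of N k] count sorted divide_right_mono del: fun_upd_apply) (simp add: A_def divide_right_mono)
qed

lemma sort_along_influence:
  assumes S: "finite S" "k \<in> S" "N > 0"
  shows "mean N S (ind (sort_along N k P)) = mean N S (ind P)"
    and "ent_influence N S (sort_along N k P) j \<le> ent_influence N S P j"
proof -
  have "mean N S (avg N k (ind (sort_along N k P))) = mean N S (avg N k (ind P))"
    by (simp add: avg_sort_along)
  then show "mean N S (ind (sort_along N k P)) = mean N S (ind P)"
    using S by (simp add: mean_avg)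
  show "ent_influence N S (sort_along N k P) j \<le> ent_influence N S P j"
  proof (cases "j = k")
    case True
    then show ?thesis by (simp add: ent_influence_def avg_sort_along)
  next
    case False
    have "mean N S (avg N k (\<lambda>y. Ent (avg N j (ind (sort_along N k P)) y))) (\<lambda>_. 0)
        \<le> mean N S (avg N k (\<lambda>y. Ent (avg N j (ind P) y))) (\<lambda>_. 0)"
      using avg_Ent_sort_along[OF False] by (intro mean_mono S)
    then show ?thesis using S by (simp add: mean_avg ent_influence_def)
  qed
qed

lemma monotone_rearrangement:
  assumes S: "finite S" "N > 0"
  shows "\<exists>Q. (\<forall>k\<in>S. decreasing_along N k Q) \<and> mean N S (ind Q) = mean N S (ind P)
    \<and> (\<forall>j. ent_influence N S Q j \<le> ent_influence N S P j)"
proof -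
  have "\<exists>Q. (\<forall>k\<in>T. decreasing_along N k Q) \<and> mean N S (ind Q) = mean N S (ind P)
    \<and> (\<forall>j. ent_influence N S Q j \<le> ent_influence N S P j)" if "finite T" "T \<subseteq> S" for T
    using that
  proof (induction T rule: finite_induct)
    case (insert k T)
    then obtain Q where Q: "\<forall>k\<in>T. decreasing_along N k Q" "mean N S (ind Q) = mean N S (ind P)"
      "\<forall>j. ent_influence N S Q j \<le> ent_influence N S P j" by auto
    have "k \<in> S" using insert.prems by simp
    note sort = sort_along_influence[OF S(1) this S(2), of Q]
    show ?case
    proof (intro exI[of _ "sort_along N k Q"] conjI allI ballI)
      show "decreasing_along N i (sort_along N k Q)" if "i \<in> insert k T" for i
        using that Q(1) decreasing_sort_along decreasing_sort_along_other by fastforce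
      show "mean N S (ind (sort_along N k Q)) = mean N S (ind P)"
        using sort(1) Q(2) by simp
      show "ent_influence N S (sort_along N k Q) j \<le> ent_influence N S P j" for j
        using sort(2)[of j] Q(3) by (meson order_trans)
    qed
  qed auto
  then show ?thesis using S(1) by blast
qed

section \<open>The inequality on the grid\<close>

text \<open>At \<open>t = 0\<close> the numerator makes the value 0, in agreement with the convention for vanishing influences.\<close>
definition log_weight :: "real \<Rightarrow> real" where
  "log_weight t = t / log 2 (4 / (3 * t))"

lemma log_weight_nonneg: "0 \<le> t \<Longrightarrow> t \<le> 1 \<Longrightarrow> 0 \<le> log_weight t"
  by (cases "t = 0") (auto simp: log_weight_def intro!: divide_nonneg_nonneg)

lemma log_weight_mono:
  assumes "0 \<le> s" "s \<le> t" "t \<le> 1"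
  shows "log_weight s \<le> log_weight t"
proof (cases "s = 0")
  case True
  then show ?thesis using log_weight_nonneg[of t] assms by (simp add: log_weight_def)
next
  case False
  then have t: "1 < 4 / (3 * t)" "4 / (3 * t) \<le> 4 / (3 * s)"
    using assms by (auto simp: field_simps)
  have "0 < log 2 (4 / (3 * t))" by (rule zero_less_log_cancel_iff[THEN iffD2]) (use t in linarith)+
  moreover have "log 2 (4 / (3 * t)) \<le> log 2 (4 / (3 * s))" by (rule log_mono) (use t in linarith)+
  ultimately show ?thesis unfolding log_weight_def using assms by (intro frac_le) auto
qed

lemma ent_influence_01:
  assumes "finite S" "N > 0"
  shows "0 \<le> ent_influence N S P k" "ent_influence N S P k \<le> 1"
proof -
  show "0 \<le> ent_influence N S P k"
    using assms by (simp add: ent_influence_def mean_nonneg Ent_nonneg)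
  have "ent_influence N S P k \<le> mean N S (\<lambda>_. 1) (\<lambda>_. 0)"
    unfolding ent_influence_def using assms avg_ind_01 by (intro mean_mono Ent_le_1) auto
  then show "ent_influence N S P k \<le> 1" using assms by (simp add: mean_const)
qed

text \<open>This absorbs the factor 2 of \<open>block_total_gap\<close>. It amounts to \<open>ln (8 / 3) \<le> 2\<close>.\<close>
lemma two_minus_ln_ge:
  fixes I J :: real
  assumes "0 < I" "I \<le> 2 * J" "J \<le> 1"
  shows "ln (4 / (3 * J)) \<le> 2 - ln I" "0 < ln (4 / (3 * J))"
proof -
  have J: "0 < J" using assms by simp
  have "ln I \<le> ln (2 * J)" using assms J by simp
  also have "\<dots> = ln 2 + ln J" using J by (simp add: ln_mult)
  finally have 1: "ln I \<le> ln 2 + ln J" .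
  have 2: "ln (4 / (3 * J)) = ln (4 / 3) - ln J" using J by (simp add: ln_div ln_mult)
  have "ln (4/3) + ln 2 = ln (4/3 * 2 :: real)" by (subst ln_mult) auto
  also have "\<dots> \<le> 8/3 - 1" using ln_le_minus_one[of "8/3 :: real"] by simp
  finally show "ln (4 / (3 * J)) \<le> 2 - ln I" using 1 2 by simp
  show "0 < ln (4 / (3 * J))" using J assms by simp
qed

text \<open>Apply Talagrand's inequality to the digits. The influence of every digit of the coordinate \<open>k\<close> is at most
  \<open>2 * J k\<close>, so the logarithms can be replaced by one that depends on \<open>J k\<close> only, and then the influences of
  these digits add up to at most \<open>2 * J k\<close>.\<close>
lemma grid_inequality_decreasing:
  fixes P :: "('k \<Rightarrow> nat) \<Rightarrow> bool" and m :: nat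
  assumes S: "finite S" and dec: "\<And>k. k \<in> S \<Longrightarrow> decreasing_along (2 ^ m) k P"
  defines "p \<equiv> mean (2 ^ m) S (ind P) (\<lambda>_. 0)"
  shows "p * (1 - p) \<le> 4 / ln 2 * (\<Sum>k\<in>S. log_weight (ent_influence (2 ^ m) S P k))"
proof -
  define F where "F y = ind P (val m y)" for y
  define B where "B = S \<times> {..<m}"
  have B: "finite B" using S by (simp add: B_def)
  define I where "I b = mean 2 B (\<lambda>y. (gap b F y)\<^sup>2) (\<lambda>_. 0)" for b
  define J where "J = ent_influence (2 ^ m) S P"
  have val0: "val m (\<lambda>_. 0) = (\<lambda>_. 0)" by (simp add: val_def fun_eq_iff)
  have I0: "0 \<le> I b" for b using B by (simp add: I_def mean_nonneg)
  have J01: "0 \<le> J k" "J k \<le> 1" for k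
    using ent_influence_01[OF S] by (auto simp: J_def)
  have block: "(\<Sum>j<m. I (k, j)) \<le> 2 * J k" if k: "k \<in> S" for k
  proof -
    let ?K = "{k} \<times> {..<m}"
    have sub: "?K \<subseteq> B" using k by (auto simp: B_def)
    have "(\<Sum>j<m. I (k, j)) = mean 2 B (\<lambda>y. \<Sum>j<m. (gap (k, j) F y)\<^sup>2) (\<lambda>_. 0)"
      using B by (simp add: I_def mean_sum)
    also have "\<dots> = mean 2 B (mean 2 ?K (\<lambda>y. \<Sum>j<m. (gap (k, j) F y)\<^sup>2)) (\<lambda>_. 0)"
      using mean_mean_subset[OF B sub] by simp
    also have "\<dots> \<le> mean 2 B (\<lambda>y. 2 * Ent (avg (2 ^ m) k (ind P) (val m y))) (\<lambda>_. 0)"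
    proof (rule mean_mono[OF B])
      fix y :: "'k \<times> nat \<Rightarrow> nat"
      have "mean 2 ?K (\<lambda>y. \<Sum>j<m. (gap (k, j) F y)\<^sup>2) y = (\<Sum>j<m. mean 2 ?K (\<lambda>y. (gap (k, j) F y)\<^sup>2) y)"
        by (simp add: mean_sum)
      also have "\<dots> \<le> 2 * Ent (avg (2 ^ m) k (ind P) (val m y))"
        using block_total_gap[OF dec[OF k]] unfolding F_def .
      finally show "mean 2 ?K (\<lambda>y. \<Sum>j<m. (gap (k, j) F y)\<^sup>2) y \<le> 2 * Ent (avg (2 ^ m) k (ind P) (val m y))" .
    qed
    also have "\<dots> = 2 * J k"
      using mean_cmult[OF B] mean_val[OF S, of m "\<lambda>x. Ent (avg (2 ^ m) k (ind P) x)" "\<lambda>_. 0"]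
      by (simp add: J_def ent_influence_def B_def val0)
    finally show ?thesis .
  qed
  have coord: "(\<Sum>j<m. I (k, j) / (2 - ln (I (k, j)))) \<le> 2 / ln 2 * log_weight (J k)" if k: "k \<in> S" for k
  proof -
    have le: "I (k, j) \<le> 2 * J k" if "j < m" for j
      using member_le_sum[of j "{..<m}" "\<lambda>j. I (k, j)"] I0 block[OF k] that by force
    have "(\<Sum>j<m. I (k, j) / (2 - ln (I (k, j)))) \<le> (\<Sum>j<m. I (k, j) / ln (4 / (3 * J k)))"
    proof (rule sum_mono)
      fix j assume "j \<in> {..<m}"
      then have "I (k, j) \<le> 2 * J k" using le by simp
      then show "I (k, j) / (2 - ln (I (k, j))) \<le> I (k, j) / ln (4 / (3 * J k))"
        using two_minus_ln_ge[of "I (k, j)" "J k"] J01[of k] I0[of "(k, j)"]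
        by (cases "I (k, j) = 0") (auto intro!: frac_le)
    qed
    also have "\<dots> = (\<Sum>j<m. I (k, j)) / ln (4 / (3 * J k))"
      by (simp add: sum_divide_distrib)
    also have "\<dots> \<le> 2 * J k / ln (4 / (3 * J k))"
    proof (cases "J k = 0")
      case False
      then have "0 < J k" using J01[of k] by simp
      then have "0 < ln (4 / (3 * J k))" using two_minus_ln_ge(2)[of "J k" "J k"] J01(2)[of k] by simp
      then show ?thesis using block[OF k] by (intro divide_right_mono) auto
    qed simp
    also have "\<dots> = 2 / ln 2 * log_weight (J k)"
      by (simp add: log_weight_def log_def)
    finally show ?thesis .
  qed
  have "mean 2 B F (\<lambda>_. 0) = p"
    using mean_val[OF S, of m "ind P" "\<lambda>_. 0"] by (simp add: p_def B_def F_def [abs_def] val0)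
  then have "p * (1 - p) \<le> 2 * (\<Sum>b\<in>B. I b / (2 - ln (I b)))"
    using talagrand[OF B, of F "\<lambda>_. 0"] by (auto simp: I_def F_def)
  also have "(\<Sum>b\<in>B. I b / (2 - ln (I b))) = (\<Sum>k\<in>S. \<Sum>j<m. I (k, j) / (2 - ln (I (k, j))))"
    by (simp add: B_def sum.cartesian_product)
  also have "\<dots> \<le> (\<Sum>k\<in>S. 2 / ln 2 * log_weight (J k))"
    by (intro sum_mono coord)
  also have "2 * \<dots> = 4 / ln 2 * (\<Sum>k\<in>S. log_weight (J k))"
    by (simp add: sum_distrib_left)
  finally show ?thesis by (simp add: J_def)
qed

theorem grid_inequality:
  fixes P :: "('k \<Rightarrow> nat) \<Rightarrow> bool" and m :: nat
  assumes S: "finite S"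
  defines "p \<equiv> mean (2 ^ m) S (ind P) (\<lambda>_. 0)"
  shows "p * (1 - p) \<le> 4 / ln 2 * (\<Sum>k\<in>S. log_weight (ent_influence (2 ^ m) S P k))"
proof -
  obtain Q where Q: "\<forall>k\<in>S. decreasing_along (2 ^ m) k Q"
    "mean (2 ^ m) S (ind Q) = mean (2 ^ m) S (ind P)"
    "\<forall>j. ent_influence (2 ^ m) S Q j \<le> ent_influence (2 ^ m) S P j"
    using monotone_rearrangement[OF S, of "2 ^ m" P] by auto
  have "p * (1 - p) \<le> 4 / ln 2 * (\<Sum>k\<in>S. log_weight (ent_influence (2 ^ m) S Q k))"
    using grid_inequality_decreasing[OF S, of m Q] Q(1,2) by (simp add: p_def)
  also have "\<dots> \<le> 4 / ln 2 * (\<Sum>k\<in>S. log_weight (ent_influence (2 ^ m) S P k))"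
    using Q(3) ent_influence_01[OF S]
    by (intro mult_left_mono sum_mono log_weight_mono) auto
  finally show ?thesis .
qed

section \<open>Dyadic cells of the unit cube\<close>

lemma space_unit_interval [simp]: "space unit_interval = {0..1}"
  by (simp add: unit_interval_def)

lemma emeasure_unit_interval:
  "A \<in> sets borel \<Longrightarrow> A \<subseteq> {0..1} \<Longrightarrow> emeasure unit_interval A = emeasure lborel A"
  unfolding unit_interval_def by (rule emeasure_restrict_space) auto

lemma finite_measure_unit_interval: "finite_measure unit_interval"
  by (rule finite_measureI) (simp add: emeasure_unit_interval)

lemma measurable_unit_interval:
  "f \<in> borel_measurable borel \<Longrightarrow> f \<in> borel_measurable unit_interval"
  unfolding unit_interval_def by (rule measurable_restrict_space1) simp

abbreviation unit_box :: "'i set \<Rightarrow> ('i \<Rightarrow> real) measure" where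
  "unit_box I \<equiv> \<Pi>\<^sub>M i\<in>I. unit_interval"

interpretation unit: product_sigma_finite "\<lambda>_ :: 'i. unit_interval"
  using finite_measure_unit_interval by (intro product_sigma_finite.intro finite_measure.axioms)

lemma emeasure_box_space: "finite I \<Longrightarrow> emeasure (unit_box I) (space (unit_box I)) = 1"
  unfolding space_PiM by (subst unit.emeasure_PiM)
    (use sets.top[of unit_interval] in \<open>auto simp: emeasure_unit_interval\<close>)

lemma finite_measure_box: "finite I \<Longrightarrow> finite_measure (unit_box I)"
  by (rule finite_measureI) (simp add: emeasure_box_space)

text \<open>The cells are half-open on the left, and 0 is put into the first one (\<open>nat\<close> maps -1 to 0). With this
  convention the right end point 1 lies in the last cell, and exactly the numbers below \<open>2 ^ m\<close> occur on
  \<open>[0,1]\<close>.\<close>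
definition cell :: "nat \<Rightarrow> real \<Rightarrow> nat" where
  "cell m t = nat (\<lceil>2 ^ m * t\<rceil> - 1)"

lemma cell_eq_iff:
  assumes "0 \<le> t"
  shows "cell m t = a \<longleftrightarrow> (real a / 2 ^ m < t \<and> t \<le> (real a + 1) / 2 ^ m) \<or> (a = 0 \<and> t = 0)"
proof (cases "t = 0")
  case False
  then have "0 < 2 ^ m * t" using assms by simp
  then have "1 \<le> \<lceil>2 ^ m * t\<rceil>" by linarith
  then have "cell m t = a \<longleftrightarrow> \<lceil>2 ^ m * t\<rceil> = int a + 1" by (auto simp: cell_def)
  also have "\<dots> \<longleftrightarrow> real a < 2 ^ m * t \<and> 2 ^ m * t \<le> real a + 1"
    by (simp add: ceiling_eq_iff)
  also have "\<dots> \<longleftrightarrow> real a / 2 ^ m < t \<and> t \<le> (real a + 1) / 2 ^ m"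
    by (simp add: field_simps)
  finally show ?thesis using False by simp
qed (auto simp: cell_def divide_less_0_iff)

lemma cell_less:
  assumes "0 \<le> t" "t \<le> 1"
  shows "cell m t < 2 ^ m"
proof -
  have "2 ^ m * t \<le> 2 ^ m" using assms by (simp add: mult_left_le)
  then have "\<lceil>2 ^ m * t\<rceil> \<le> 2 ^ m" by (simp add: ceiling_le_iff)
  then have "nat (\<lceil>2 ^ m * t\<rceil> - 1) < nat (2 ^ m)" by (simp add: nat_less_iff)
  then show ?thesis by (simp add: cell_def nat_power_eq)
qed

lemma cell_mono: "s \<le> t \<Longrightarrow> cell m s \<le> cell m t"
  unfolding cell_def by (intro nat_mono diff_right_mono ceiling_mono mult_left_mono) auto

lemma cell_Suc: "0 \<le> t \<Longrightarrow> cell m t = cell (Suc m) t div 2"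
proof -
  assume t: "0 \<le> t"
  define a where "a = cell (Suc m) t"
  have a: "(real a / 2 ^ Suc m < t \<and> t \<le> (real a + 1) / 2 ^ Suc m) \<or> (a = 0 \<and> t = 0)"
    using cell_eq_iff[OF t] a_def by metis
  have "real (2 * (a div 2)) \<le> real a" "real (a + 1) \<le> real (2 * (a div 2 + 1))"
    unfolding of_nat_le_iff by presburger+
  then have half: "real (a div 2) \<le> real a / 2" "(real a + 1) / 2 \<le> real (a div 2) + 1" by auto
  have "real (a div 2) / 2 ^ m \<le> real a / 2 ^ Suc m"
    "(real a + 1) / 2 ^ Suc m \<le> (real (a div 2) + 1) / 2 ^ m"
    using divide_right_mono[OF half(1), of "2 ^ m"] divide_right_mono[OF half(2), of "2 ^ m"] by simp_all
  with a have "cell m t = a div 2"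
    unfolding cell_eq_iff[OF t] by auto
  then show ?thesis by (simp add: a_def)
qed

lemma measurable_cell [measurable (raw)]:
  "f \<in> borel_measurable M \<Longrightarrow> (\<lambda>x. cell m (f x)) \<in> M \<rightarrow>\<^sub>M count_space UNIV"
  unfolding cell_def by measurable

lemma measurable_ident_unit_interval: "(\<lambda>t. t) \<in> borel_measurable unit_interval"
  by (rule measurable_unit_interval) simp

lemma measure_cell:
  assumes "a < 2 ^ m"
  shows "measure unit_interval {t \<in> {0..1}. cell m t = a} = 1 / 2 ^ m"
proof -
  have "real a + 1 \<le> 2 ^ m"
    using of_nat_mono[OF Suc_leI[OF assms], where ?'a = real] by simp
  then have a: "(real a + 1) / 2 ^ m \<le> 1" by simp
  have a0: "0 \<le> real a / 2 ^ m" by simp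
  have "{t \<in> {0..1}. cell m t = a} = (if a = 0 then {0..1 / 2 ^ m} else {real a / 2 ^ m<..(real a + 1) / 2 ^ m})"
  proof (rule set_eqI)
    fix t :: real
    show "t \<in> {t \<in> {0..1}. cell m t = a}
        \<longleftrightarrow> t \<in> (if a = 0 then {0..1 / 2 ^ m} else {real a / 2 ^ m<..(real a + 1) / 2 ^ m})"
    proof (cases "0 \<le> t")
      case True
      have "0 < a \<Longrightarrow> 0 < real a / 2 ^ m" by simp
      then show ?thesis
        using order_trans[OF _ a, of t] a0 True unfolding mem_Collect_eq cell_eq_iff[OF True] by (cases "a = 0") auto
    next
      case False
      moreover have "\<not> real a / 2 ^ m < t" using False a0 by linarith
      ultimately show ?thesis by simp
    qed
  qed
  also have "measure lborel \<dots> = 1 / 2 ^ m"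
    by (simp add: add_divide_distrib)
  finally have "measure lborel {t \<in> {0..1}. cell m t = a} = 1 / 2 ^ m" .
  moreover have "{t \<in> {0..1}. cell m t = a} \<in> sets borel" by measurable
  then have "emeasure unit_interval {t \<in> {0..1}. cell m t = a} = emeasure lborel {t \<in> {0..1}. cell m t = a}"
    by (rule emeasure_unit_interval) auto
  ultimately show ?thesis by (simp only: measure_def)
qed

lemma integral_cell: "(\<integral>t. g (cell m t) \<partial>unit_interval) = (\<Sum>a<2 ^ m. g a) / 2 ^ m" for g :: "nat \<Rightarrow> real"
proof -
  interpret finite_measure unit_interval by (rule finite_measure_unit_interval)
  define C where "C a = {t \<in> space unit_interval. cell m t = a}" for a
  have C: "C a \<in> sets unit_interval" for a 
    unfolding C_def using measurable_ident_unit_interval by measurable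
  have C_Int: "C a \<inter> {0..1} = C a" for a by (auto simp: C_def)
  have "(\<integral>t. g (cell m t) \<partial>unit_interval) = (\<integral>t. (\<Sum>a<2 ^ m. g a * indicator (C a) t) \<partial>unit_interval)"
  proof (rule Bochner_Integration.integral_cong[OF refl])
    fix t assume t: "t \<in> space unit_interval"
    then have "cell m t < 2 ^ m" using cell_less by simp
    moreover have "(\<Sum>a<2 ^ m. g a * indicator (C a) t) = (\<Sum>a<2 ^ m. if a = cell m t then g a else 0)"
      using t by (intro sum.cong) (auto simp: indicator_def C_def)
    ultimately show "g (cell m t) = (\<Sum>a<2 ^ m. g a * indicator (C a) t)" by simp
  qed
  also have "\<dots> = (\<Sum>a<2 ^ m. g a * measure unit_interval (C a))"
    using C by (subst Bochner_Integration.integral_sum) (auto simp: emeasure_finite less_top[symmetric] C_Int)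
  also have "\<dots> = (\<Sum>a<2 ^ m. g a / 2 ^ m)"
    using measure_cell unfolding C_def space_unit_interval by (intro sum.cong) auto
  finally show ?thesis by (simp add: sum_divide_distrib)
qed

definition cells :: "'i set \<Rightarrow> nat \<Rightarrow> ('i \<Rightarrow> real) \<Rightarrow> 'i \<Rightarrow> nat" where
  "cells I m x i = (if i \<in> I then cell m (x i) else 0)"

lemma measurable_coordinate: "i \<in> I \<Longrightarrow> (\<lambda>x. x i) \<in> borel_measurable (unit_box I)"
  using measurable_compose[OF measurable_component_singleton[of i I "\<lambda>_. unit_interval"]
      measurable_ident_unit_interval] .

lemma measurable_cells:
  fixes G :: "('i \<Rightarrow> nat) \<Rightarrow> real"
  assumes I: "finite I"
  shows "(\<lambda>x. G (cells I m x)) \<in> borel_measurable (unit_box I)"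
proof -
  let ?A = "\<Pi>\<^sub>E i\<in>I. {..<2 ^ m :: nat}"
  have fin: "finite ?A" using I by (intro finite_PiE) auto
  let ?g = "\<lambda>x. \<Sum>a\<in>?A. G (\<lambda>i. if i \<in> I then a i else 0) * (of_bool (\<forall>i\<in>I. cell m (x i) = a i) :: real)"
  have "G (cells I m x) = ?g x" if x: "x \<in> space (unit_box I)" for x
  proof -
    let ?a = "\<lambda>i\<in>I. cell m (x i)"
    have a: "?a \<in> ?A" using x by (auto simp: space_PiM PiE_iff cell_less)
    have "(\<forall>i\<in>I. cell m (x i) = a i) \<longleftrightarrow> a = ?a" if "a \<in> ?A" for a
      using that by (auto simp: PiE_iff extensional_def fun_eq_iff)
    then have "?g x = (\<Sum>a\<in>?A. if a = ?a then G (\<lambda>i. if i \<in> I then a i else 0) else 0)"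
      by (intro sum.cong) auto
    also have "\<dots> = G (\<lambda>i. if i \<in> I then ?a i else 0)" using a fin by simp
    also have "(\<lambda>i. if i \<in> I then ?a i else 0) = cells I m x" by (auto simp: cells_def fun_eq_iff)
    finally show ?thesis by simp
  qed
  moreover have "?g \<in> borel_measurable (unit_box I)"
  proof (intro borel_measurable_sum borel_measurable_times borel_measurable_const)
    fix a
    have "Measurable.pred (unit_box I) (\<lambda>x. \<forall>i\<in>I. cell m (x i) = a i)"
      using I measurable_coordinate by (intro pred_intros_finite) measurable
    then show "(\<lambda>x. of_bool (\<forall>i\<in>I. cell m (x i) = a i) :: real) \<in> borel_measurable (unit_box I)"
      by (rule measurable_compose) simp
  qed
  ultimately show ?thesis using measurable_cong[of "unit_box I" "\<lambda>x. G (cells I m x)" ?g borel] by blast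
qed

lemma integrable_bounded:
  fixes f :: "'a \<Rightarrow> real"
  assumes "finite_measure M" "f \<in> borel_measurable M" "\<And>x. x \<in> space M \<Longrightarrow> \<bar>f x\<bar> \<le> B"
  shows "integrable M f"
  by (rule finite_measure.integrable_const_bound[OF assms(1) AE_I2[of M "\<lambda>x. norm (f x) \<le> B"] assms(2)]) (simp add: assms(3))

lemma abs_cells_le:
  fixes G :: "('i \<Rightarrow> nat) \<Rightarrow> real"
  assumes I: "finite I" and x: "x \<in> space (unit_box I)"
  shows "\<bar>G (cells I m x)\<bar> \<le> (\<Sum>a\<in>PiE I (\<lambda>_. {..<2 ^ m}). \<bar>G (\<lambda>i. if i \<in> I then a i else 0)\<bar>)"
proof -
  let ?A = "\<Pi>\<^sub>E i\<in>I. {..<2 ^ m :: nat}"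
  have fin: "finite ?A" using I by (intro finite_PiE) auto
  define a where "a = (\<lambda>i\<in>I. cell m (x i))"
  have a: "a \<in> ?A" using x by (auto simp: a_def space_PiM PiE_iff cell_less)
  have "cells I m x = (\<lambda>i. if i \<in> I then a i else 0)" by (auto simp: a_def cells_def fun_eq_iff)
  then have "\<bar>G (cells I m x)\<bar> = \<bar>G (\<lambda>i. if i \<in> I then a i else 0)\<bar>" by simp
  also have "\<dots> \<le> (\<Sum>a\<in>?A. \<bar>G (\<lambda>i. if i \<in> I then a i else 0)\<bar>)"
    using member_le_sum[of a ?A "\<lambda>a. \<bar>G (\<lambda>i. if i \<in> I then a i else 0)\<bar>"] a fin by simp
  finally show ?thesis .
qed

lemma integrable_cells:
  fixes G :: "('i \<Rightarrow> nat) \<Rightarrow> real"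
  assumes "finite I"
  shows "integrable (unit_box I) (\<lambda>x. G (cells I m x))"
proof (rule integrable_bounded)
  show "finite_measure (unit_box I)" by (rule finite_measure_box[OF assms])
  show "(\<lambda>x. G (cells I m x)) \<in> borel_measurable (unit_box I)" by (rule measurable_cells[OF assms])
  show "\<bar>G (cells I m x)\<bar> \<le> (\<Sum>a\<in>PiE I (\<lambda>_. {..<2 ^ m}). \<bar>G (\<lambda>i. if i \<in> I then a i else 0)\<bar>)"
    if "x \<in> space (unit_box I)" for x
    by (rule abs_cells_le[OF assms that])
qed

text \<open>Under Lebesgue measure the vector of cell numbers is uniform on the grid, so integrals become the averages
  used above.\<close>
lemma integral_cells:
  assumes "finite I"
  shows "(\<integral>x. G (cells I m x) \<partial>unit_box I) = mean (2 ^ m) I G (\<lambda>_. 0)"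
  using assms
proof (induction I arbitrary: G rule: finite_induct)
  case empty
  have "cells {} m x = (\<lambda>_. 0)" for x :: "'a \<Rightarrow> real" by (simp add: cells_def fun_eq_iff)
  then show ?case
    using emeasure_box_space[of "{} :: 'a set"] by (simp add: measure_def)
next
  case (insert k I)
  have upd: "cells (insert k I) m (x(k := t)) = (cells I m x)(k := cell m t)" for x t
    using insert.hyps by (auto simp: cells_def fun_eq_iff)
  have inner: "(\<integral>t. G (cells (insert k I) m (x(k := t))) \<partial>unit_interval) = avg (2 ^ m) k G (cells I m x)" for x
    using integral_cell[of "\<lambda>a. G ((cells I m x)(k := a))" m]
    by (simp only: upd avg_def of_nat_power of_nat_numeral)
  have "(\<integral>x. G (cells (insert k I) m x) \<partial>unit_box (insert k I))
      = (\<integral>x. \<integral>t. G (cells (insert k I) m (x(k := t))) \<partial>unit_interval \<partial>unit_box I)"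
    by (rule unit.product_integral_insert[OF insert.hyps(1,2) integrable_cells]) (simp add: insert.hyps)
  also have "\<dots> = (\<integral>x. avg (2 ^ m) k G (cells I m x) \<partial>unit_box I)"
    unfolding inner ..
  also have "\<dots> = mean (2 ^ m) I (avg (2 ^ m) k G) (\<lambda>_. 0)" by (rule insert.IH)
  finally show ?case using insert.hyps by (simp add: mean_insert avg_mean)
qed

section \<open>Approximation of measurable sets by dyadic sets\<close>

definition grid_set :: "'i set \<Rightarrow> nat \<Rightarrow> (('i \<Rightarrow> nat) \<Rightarrow> bool) \<Rightarrow> ('i \<Rightarrow> real) set" where
  "grid_set I m P = {x \<in> space (unit_box I). P (cells I m x)}"

lemma sets_grid_set:
  assumes "finite I"
  shows "grid_set I m P \<in> sets (unit_box I)"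
proof -
  have "(\<lambda>x. ind P (cells I m x)) -` {1} \<inter> space (unit_box I) \<in> sets (unit_box I)"
    by (rule measurable_sets[OF measurable_cells[OF assms]]) simp
  moreover have "(\<lambda>x. ind P (cells I m x)) -` {1} \<inter> space (unit_box I) = grid_set I m P"
    by (auto simp: grid_set_def)
  ultimately show ?thesis by simp
qed

lemma measure_grid_set:
  assumes "finite I"
  shows "measure (unit_box I) (grid_set I m P) = mean (2 ^ m) I (ind P) (\<lambda>_. 0)"
proof -
  have "grid_set I m P \<inter> space (unit_box I) = grid_set I m P" by (auto simp: grid_set_def)
  then have "measure (unit_box I) (grid_set I m P) = (\<integral>x. indicator (grid_set I m P) x \<partial>unit_box I)"
    by simp
  also have "\<dots> = (\<integral>x. ind P (cells I m x) \<partial>unit_box I)"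
    by (rule Bochner_Integration.integral_cong[OF refl]) (simp add: grid_set_def indicator_def)
  also have "\<dots> = mean (2 ^ m) I (ind P) (\<lambda>_. 0)"
    by (rule integral_cells[OF assms])
  finally show ?thesis .
qed

text \<open>Two unions of cells can be compared after passing to a common level.\<close>
lemma grid_set_refine: "\<exists>Q. grid_set I m P = grid_set I (m + r) Q"
proof (induction r)
  case (Suc r)
  then obtain Q where Q: "grid_set I m P = grid_set I (m + r) Q" by auto
  have "cells I (m + r) x = (\<lambda>i. cells I (m + Suc r) x i div 2)" if "x \<in> space (unit_box I)" for x
  proof
    fix i
    show "cells I (m + r) x i = cells I (m + Suc r) x i div 2"
    proof (cases "i \<in> I")
      case True
      then have "0 \<le> x i" using that by (auto simp: space_PiM PiE_iff)
      from cell_Suc[OF this, of "m + r"] show ?thesis using True by (simp add: cells_def)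
    qed (simp add: cells_def)
  qed
  then have "grid_set I (m + r) Q = grid_set I (m + Suc r) (\<lambda>a. Q (\<lambda>i. a i div 2))"
    by (auto simp: grid_set_def)
  with Q show ?case by blast
qed auto

text \<open>The approximable sets are shown to form a \<open>\<sigma>\<close>-algebra that contains the half-spaces, and hence all
  measurable sets.\<close>
definition grid_approximable :: "'i set \<Rightarrow> ('i \<Rightarrow> real) set \<Rightarrow> bool" where
  "grid_approximable I A \<longleftrightarrow> A \<in> sets (unit_box I) \<and>
    (\<forall>e>0. \<exists>m P. measure (unit_box I) ((A - grid_set I m P) \<union> (grid_set I m P - A)) < e)"

lemma grid_approximableI:
  assumes "A \<in> sets (unit_box I)"
    and "\<And>e. e > 0 \<Longrightarrow>
      \<exists>m P. measure (unit_box I) ((A - grid_set I m P) \<union> (grid_set I m P - A)) < e"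
  shows "grid_approximable I A"
  using assms unfolding grid_approximable_def by (intro conjI allI impI)

lemma grid_approximable_sets: "grid_approximable I A \<Longrightarrow> A \<in> sets (unit_box I)"
  unfolding grid_approximable_def by (rule conjunct1)

lemma grid_approximableE:
  assumes "grid_approximable I A" "e > 0"
  obtains m P where "measure (unit_box I) ((A - grid_set I m P) \<union> (grid_set I m P - A)) < e"
  using assms unfolding grid_approximable_def by blast

lemma algebra_grid_approximable:
  assumes I: "finite I"
  shows "algebra (space (unit_box I)) {A. grid_approximable I A}"
  unfolding algebra_iff_Un
proof (intro conjI ballI)
  show "{A. grid_approximable I A} \<subseteq> Pow (space (unit_box I))"
    using grid_approximable_sets sets.sets_into_space by blast
  have "grid_set I 0 (\<lambda>_. False) = {}" by (simp add: grid_set_def)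
  then have "grid_approximable I {}"
    by (intro grid_approximableI exI[of _ 0] exI[of _ "\<lambda>_. False"]) simp_all
  then show "{} \<in> {A. grid_approximable I A}" by simp
next
  fix A assume "A \<in> {A. grid_approximable I A}"
  then have A: "grid_approximable I A" by simp
  note A_sets = grid_approximable_sets[OF A]
  have "grid_approximable I (space (unit_box I) - A)"
  proof (rule grid_approximableI)
    fix e :: real assume "e > 0"
    with A obtain m P where "measure (unit_box I) ((A - grid_set I m P) \<union> (grid_set I m P - A)) < e"
      by (rule grid_approximableE)
    moreover have "(space (unit_box I) - A - grid_set I m (\<lambda>a. \<not> P a)) \<union> (grid_set I m (\<lambda>a. \<not> P a) - (space (unit_box I) - A))
        = (A - grid_set I m P) \<union> (grid_set I m P - A)"
      using sets.sets_into_space[OF A_sets] unfolding grid_set_def by blast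
    ultimately show "\<exists>m P. measure (unit_box I) ((space (unit_box I) - A - grid_set I m P)
        \<union> (grid_set I m P - (space (unit_box I) - A))) < e"
      by (intro exI[of _ m] exI[of _ "\<lambda>a. \<not> P a"]) simp
  qed (use A_sets in simp)
  then show "space (unit_box I) - A \<in> {A. grid_approximable I A}" by simp
next
  interpret finite_measure "unit_box I" by (rule finite_measure_box[OF I])
  note [measurable] = sets_grid_set[OF I]
  fix A B assume "A \<in> {A. grid_approximable I A}" "B \<in> {A. grid_approximable I A}"
  then have A: "grid_approximable I A" and B: "grid_approximable I B" by simp_all
  have [measurable]: "A \<in> sets (unit_box I)" "B \<in> sets (unit_box I)"
    using A B by (simp_all add: grid_approximable_sets)
  have "grid_approximable I (A \<union> B)"
  proof (rule grid_approximableI)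
    fix e :: real assume "e > 0"
    then have e: "e / 2 > 0" by simp
    obtain m P where P: "measure (unit_box I) ((A - grid_set I m P) \<union> (grid_set I m P - A)) < e / 2"
      using A e by (rule grid_approximableE)
    obtain r Q where Q: "measure (unit_box I) ((B - grid_set I r Q) \<union> (grid_set I r Q - B)) < e / 2"
      using B e by (rule grid_approximableE)
    obtain P' where P': "grid_set I m P = grid_set I (m + r) P'"
      using grid_set_refine by blast
    obtain Q' where Q': "grid_set I r Q = grid_set I (m + r) Q'"
      using grid_set_refine[of I r Q m] unfolding add.commute[of r m] by blast
    define R where "R = grid_set I (m + r) (\<lambda>a. P' a \<or> Q' a)"
    have R: "R = grid_set I m P \<union> grid_set I r Q"
      unfolding P' Q' R_def unfolding grid_set_def by blast
    have "measure (unit_box I) ((A \<union> B - R) \<union> (R - (A \<union> B)))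
        \<le> measure (unit_box I) (((A - grid_set I m P) \<union> (grid_set I m P - A))
            \<union> ((B - grid_set I r Q) \<union> (grid_set I r Q - B)))"
      unfolding R by (rule finite_measure_mono) (blast, measurable)
    also have "\<dots> \<le> measure (unit_box I) ((A - grid_set I m P) \<union> (grid_set I m P - A))
        + measure (unit_box I) ((B - grid_set I r Q) \<union> (grid_set I r Q - B))"
      by (rule measure_Un_le) measurable
    also have "\<dots> < e" using P Q by linarith
    finally show "\<exists>m P. measure (unit_box I) ((A \<union> B - grid_set I m P) \<union> (grid_set I m P - (A \<union> B))) < e"
      unfolding R_def by blast
  qed simp
  then show "A \<union> B \<in> {A. grid_approximable I A}" by simp
qed

lemma sigma_algebra_grid_approximable:
  assumes I: "finite I"
  shows "sigma_algebra (space (unit_box I)) {A. grid_approximable I A}"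
  unfolding sigma_algebra_iff
proof (intro conjI allI impI algebra_grid_approximable[OF I])
  interpret finite_measure "unit_box I" by (rule finite_measure_box[OF I])
  interpret G: algebra "space (unit_box I)" "{A. grid_approximable I A}"
    by (rule algebra_grid_approximable[OF I])
  note [measurable] = sets_grid_set[OF I]
  fix A :: "nat \<Rightarrow> _" assume A: "range A \<subseteq> {A. grid_approximable I A}"
  define L where "L k = (\<Union>i<k. A i)" for k
  define U where "U = (\<Union>i. A i)"
  have UL: "U = (\<Union>k. L k)" by (auto simp: L_def U_def)
  have sub: "L k \<subseteq> U" for k by (auto simp: L_def U_def)
  have L: "grid_approximable I (L k)" for k
    using G.finite_UN[of "{..<k}" A] A by (auto simp: L_def)
  have L_sets [measurable]: "L k \<in> sets (unit_box I)" for k using L by (rule grid_approximable_sets)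
  have [measurable]: "U \<in> sets (unit_box I)" unfolding UL by measurable
  have L_inc: "incseq L"
    unfolding incseq_def L_def by (intro allI impI UN_mono) auto
  have lim: "(\<lambda>k. measure (unit_box I) (L k)) \<longlonglongrightarrow> measure (unit_box I) U"
    unfolding UL by (rule finite_Lim_measure_incseq) (use L_sets L_inc in auto)
  have "grid_approximable I U"
  proof (rule grid_approximableI)
    fix e :: real assume "e > 0"
    then have e: "e / 2 > 0" by simp
    have "\<forall>\<^sub>F k in sequentially. measure (unit_box I) U - e / 2 < measure (unit_box I) (L k)"
      using e by (intro order_tendstoD(1)[OF lim]) linarith
    then obtain k where k: "measure (unit_box I) U - e / 2 < measure (unit_box I) (L k)"
      unfolding eventually_sequentially by blast
    obtain m P where P: "measure (unit_box I) ((L k - grid_set I m P) \<union> (grid_set I m P - L k)) < e / 2"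
      using L e by (rule grid_approximableE)
    have "measure (unit_box I) ((U - grid_set I m P) \<union> (grid_set I m P - U))
        \<le> measure (unit_box I) ((U - L k) \<union> ((L k - grid_set I m P) \<union> (grid_set I m P - L k)))"
      using sub[of k] by (intro finite_measure_mono) (blast, measurable)
    also have "\<dots> \<le> measure (unit_box I) (U - L k)
        + measure (unit_box I) ((L k - grid_set I m P) \<union> (grid_set I m P - L k))"
      by (rule measure_Un_le) measurable
    also have "measure (unit_box I) (U - L k) = measure (unit_box I) U - measure (unit_box I) (L k)"
      using sub by (intro finite_measure_Diff) measurable
    finally have "measure (unit_box I) ((U - grid_set I m P) \<union> (grid_set I m P - U)) < e"
      using k P by linarith
    then show "\<exists>m P. measure (unit_box I) ((U - grid_set I m P) \<union> (grid_set I m P - U)) < e" by blast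
  qed measurable
  then show "(\<Union>i. A i) \<in> {A. grid_approximable I A}" by (simp add: U_def)
qed

lemma coordinate_01:
  assumes "x \<in> space (unit_box I)" "i \<in> I"
  shows "0 \<le> x i" "x i \<le> 1"
  using assms by (auto simp: space_PiM PiE_iff)

text \<open>The cells to the left of the one that contains \<open>c\<close> approximate the half-space up to a slab of
  thickness \<open>1 / 2 ^ m\<close>.\<close>
lemma grid_approximable_halfspace:
  assumes I: "finite I" "i \<in> I"
  shows "grid_approximable I {x \<in> space (unit_box I). x i \<le> c}"
proof -
  interpret finite_measure "unit_box I" by (rule finite_measure_box[OF I(1)])
  let ?A = "{x \<in> space (unit_box I). x i \<le> c}"
  show ?thesis
  proof (rule grid_approximableI)
    fix e :: real assume "e > 0"
    consider "c < 0" | "c > 1" | "0 \<le> c" "c \<le> 1" by linarith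
    then show "\<exists>m P. measure (unit_box I) ((?A - grid_set I m P) \<union> (grid_set I m P - ?A)) < e"
    proof cases
      case 1
      have "\<not> x i \<le> c" if "x \<in> space (unit_box I)" for x
        using coordinate_01(1)[OF that I(2)] 1 by linarith
      then have "?A = {}" by blast
      moreover have "grid_set I 0 (\<lambda>_. False) = {}" by (simp add: grid_set_def)
      ultimately have "(?A - grid_set I 0 (\<lambda>_. False)) \<union> (grid_set I 0 (\<lambda>_. False) - ?A) = {}" by blast
      with \<open>e > 0\<close> have "measure (unit_box I) ((?A - grid_set I 0 (\<lambda>_. False)) \<union> (grid_set I 0 (\<lambda>_. False) - ?A)) < e"
        by (simp only: measure_empty)
      then show ?thesis by (intro exI[of _ 0] exI[of _ "\<lambda>_. False"])
    next
      case 2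
      have "x i \<le> c" if "x \<in> space (unit_box I)" for x
        using coordinate_01(2)[OF that I(2)] 2 by linarith
      then have "?A = space (unit_box I)" by blast
      moreover have "grid_set I 0 (\<lambda>_. True) = space (unit_box I)" by (simp add: grid_set_def)
      ultimately have "(?A - grid_set I 0 (\<lambda>_. True)) \<union> (grid_set I 0 (\<lambda>_. True) - ?A) = {}" by blast
      with \<open>e > 0\<close> have "measure (unit_box I) ((?A - grid_set I 0 (\<lambda>_. True)) \<union> (grid_set I 0 (\<lambda>_. True) - ?A)) < e"
        by (simp only: measure_empty)
      then show ?thesis by (intro exI[of _ 0] exI[of _ "\<lambda>_. True"])
    next
      case 3
      obtain m where m: "(1 / 2) ^ m < e" using real_arch_pow_inv[OF \<open>e > 0\<close>, of "1 / 2"] by auto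
      let ?P = "\<lambda>a :: _ \<Rightarrow> nat. a i < cell m c" and ?E = "\<lambda>a :: _ \<Rightarrow> nat. a i = cell m c"
      have "(?A - grid_set I m ?P) \<union> (grid_set I m ?P - ?A) \<subseteq> grid_set I m ?E"
      proof
        fix x assume x: "x \<in> (?A - grid_set I m ?P) \<union> (grid_set I m ?P - ?A)"
        then have sp: "x \<in> space (unit_box I)" by (auto simp: grid_set_def)
        have "x i \<le> c \<longleftrightarrow> \<not> cell m (x i) < cell m c"
          using x sp I(2) by (auto simp: grid_set_def cells_def)
        moreover have "cell m (x i) \<le> cell m c" if "x i \<le> c" using that by (rule cell_mono)
        moreover have "cell m c \<le> cell m (x i)" if "c \<le> x i" using that by (rule cell_mono)
        ultimately have "cell m (x i) = cell m c" by linarith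
        then show "x \<in> grid_set I m ?E" using sp I(2) by (simp add: grid_set_def cells_def)
      qed
      then have "measure (unit_box I) ((?A - grid_set I m ?P) \<union> (grid_set I m ?P - ?A)) \<le> measure (unit_box I) (grid_set I m ?E)"
        by (rule finite_measure_mono) (rule sets_grid_set[OF I(1)])
      also have "\<dots> = mean (2 ^ m) I (ind ?E) (\<lambda>_. 0)"
        by (rule measure_grid_set[OF I(1)])
      also have "\<dots> = mean (2 ^ m) I (avg (2 ^ m) i (ind ?E)) (\<lambda>_. 0)"
        using I by (simp add: mean_avg)
      also have "avg (2 ^ m) i (ind ?E) = (\<lambda>_. 1 / 2 ^ m)"
      proof
        fix y :: "'a \<Rightarrow> nat"
        have "{t. t < 2 ^ m \<and> t = cell m c} = {cell m c}" using cell_less[OF 3, of m] by blast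
        then show "avg (2 ^ m) i (ind ?E) y = 1 / 2 ^ m" by (simp add: avg_of_bool)
      qed
      also have "mean (2 ^ m) I (\<lambda>_. 1 / 2 ^ m) (\<lambda>_. 0) = (1 / 2) ^ m"
        using I by (simp add: mean_const power_one_over)
      finally have "measure (unit_box I) ((?A - grid_set I m ?P) \<union> (grid_set I m ?P - ?A)) < e"
        using m by linarith
      then show ?thesis by (intro exI[of _ m] exI[of _ ?P])
    qed
  next
    have eq: "?A = (\<lambda>x. x i) -` {..c} \<inter> space (unit_box I)" by auto
    show "?A \<in> sets (unit_box I)"
      unfolding eq by (rule measurable_sets[OF measurable_coordinate[OF I(2)]]) simp
  qed
qed

text \<open>Equip the cube with the \<open>\<sigma>\<close>-algebra of approximable sets. All coordinates are measurable with respect to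
  it, so it contains the product \<open>\<sigma>\<close>-algebra.\<close>
theorem grid_approximation:
  assumes I: "finite I" and A: "A \<in> sets (unit_box I)"
  shows "grid_approximable I A"
proof -
  let ?N = "measure_of (space (unit_box I)) {A. grid_approximable I A} (\<lambda>_. 0)"
  interpret sigma_algebra "space (unit_box I)" "{A. grid_approximable I A}"
    by (rule sigma_algebra_grid_approximable[OF I])
  have sets_N: "sets ?N = {A. grid_approximable I A}" by simp
  have space_N: "space ?N = space (unit_box I)" using space_closed by (intro space_measure_of) auto
  have "(\<lambda>x. x) \<in> ?N \<rightarrow>\<^sub>M unit_box I"
  proof (rule measurable_PiM_single')
    fix i assume i: "i \<in> I"
    have "(\<lambda>x. x i) \<in> borel_measurable ?N"
      by (rule borel_measurableI_le)
        (unfold sets_N space_N mem_Collect_eq, rule grid_approximable_halfspace[OF I i])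
    then have "(\<lambda>x. x i) \<in> ?N \<rightarrow>\<^sub>M lborel" by (simp only: measurable_lborel1)
    moreover have "(\<lambda>x. x i) \<in> space ?N \<rightarrow> {0..1}"
    proof
      show "x i \<in> {0..1}" if "x \<in> space ?N" for x
        using coordinate_01[OF _ i] that unfolding space_N by simp
    qed
    ultimately show "(\<lambda>x. x i) \<in> ?N \<rightarrow>\<^sub>M unit_interval"
      unfolding unit_interval_def by (intro measurable_restrict_space2)
  next
    show "(\<lambda>x i. x i) \<in> space ?N \<rightarrow> I \<rightarrow>\<^sub>E space unit_interval"
      unfolding space_N unfolding space_PiM by (rule funcsetI)
  qed
  from measurable_sets[OF this A] have "A \<inter> space (unit_box I) \<in> {A. grid_approximable I A}"
    by (simp only: sets_N space_N vimage_ident)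
  moreover have "A \<inter> space (unit_box I) = A" using sets.sets_into_space[OF A] by auto
  ultimately show ?thesis by simp
qed

section \<open>Passage to the continuous cube\<close>

text \<open>A concave function grows most near the left end point and falls most near the right one.\<close>
lemma Ent_diff_le:
  assumes "0 \<le> a" "a \<le> b" "b \<le> 1"
  shows "\<bar>Ent a - Ent b\<bar> \<le> Ent (b - a)"
proof -
  have "Ent 0 + Ent b \<le> Ent a + Ent (b - a)"
    by (rule concave_on_exchange[OF concave_on_Ent]) (use assms in auto)
  moreover have "Ent 0 + Ent (1 - a) \<le> Ent (1 - b) + Ent (b - a)"
    by (rule concave_on_exchange[OF concave_on_Ent]) (use assms in auto)
  ultimately show ?thesis by (simp add: Ent_one_minus)
qed

lemma Ent_linear_bound:
  assumes "0 \<le> t" "t \<le> 1" "m > 0"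
  shows "Ent t \<le> (m + t * (1 - ln m)) / ln 2"
proof -
  have "t * ln m + t - m \<le> t * ln t" by (rule x_ln_x_tangent[OF assms(1,3)])
  moreover have "(1 - t) * ln 1 + (1 - t) - 1 \<le> (1 - t) * ln (1 - t)"
    using assms by (intro x_ln_x_tangent) auto
  ultimately have "- (t * ln t + (1 - t) * ln (1 - t)) \<le> m + t * (1 - ln m)"
    using assms(1) by (simp add: algebra_simps)
  then show ?thesis unfolding Ent_eq[OF assms(1,2)] by (intro divide_right_mono) auto
qed

text \<open>\<open>Ent\<close> is not Lipschitz near the end points. An affine modulus with arbitrarily small constant term replaces
  uniform continuity and can be integrated directly.\<close>
lemma Ent_modulus:
  assumes "\<delta> > 0"
  obtains C where "C \<ge> 0"
    "\<And>a b. 0 \<le> a \<Longrightarrow> a \<le> 1 \<Longrightarrow> 0 \<le> b \<Longrightarrow> b \<le> 1 \<Longrightarrow> \<bar>Ent a - Ent b\<bar> \<le> \<delta> + C * \<bar>a - b\<bar>"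
proof
  define m where "m = \<delta> * ln 2"
  define C where "C = \<bar>1 - ln m\<bar> / ln 2"
  have m: "m > 0" using assms by (simp add: m_def)
  show "C \<ge> 0" by (simp add: C_def)
  have le: "\<bar>Ent a - Ent b\<bar> \<le> \<delta> + C * \<bar>a - b\<bar>" if "0 \<le> a" "a \<le> b" "b \<le> 1" for a b
  proof -
    have "\<bar>Ent a - Ent b\<bar> \<le> Ent (b - a)" using that by (rule Ent_diff_le)
    also have "\<dots> \<le> (m + (b - a) * (1 - ln m)) / ln 2"
      using that m by (intro Ent_linear_bound) auto
    also have "\<dots> \<le> (m + (b - a) * \<bar>1 - ln m\<bar>) / ln 2"
      using that by (intro divide_right_mono add_left_mono mult_left_mono) auto
    also have "\<dots> = \<delta> + C * \<bar>a - b\<bar>"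
      using that by (simp add: m_def C_def add_divide_distrib)
    finally show ?thesis .
  qed
  show "\<bar>Ent a - Ent b\<bar> \<le> \<delta> + C * \<bar>a - b\<bar>" if "0 \<le> a" "a \<le> 1" "0 \<le> b" "b \<le> 1" for a b
  proof (cases "a \<le> b")
    case True
    then show ?thesis using le that by simp
  next
    case False
    then have "b \<le> a" by simp
    from le[OF that(3) this that(2)] show ?thesis by (simp add: abs_minus_commute)
  qed
qed

text \<open>A concave function on \<open>[0,1]\<close> is continuous in the interior and may jump only at the two end points.\<close>
lemma borel_measurable_concave:
  fixes h :: "real \<Rightarrow> real"
  assumes h: "concave_on {0..1} h" and q: "q \<in> borel_measurable M"
    and q01: "\<And>x. x \<in> space M \<Longrightarrow> 0 \<le> q x \<and> q x \<le> 1"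
  shows "(\<lambda>x. h (q x)) \<in> borel_measurable M"
proof -
  define H where "H t = indicator {0<..<1} t *\<^sub>R h t" for t :: real
  have "convex_on {0<..<1} (\<lambda>t. - h t)"
    using h unfolding concave_on_def by (rule convex_on_subset) auto
  then have "continuous_on {0<..<1} (\<lambda>t. - h t)"
    by (intro convex_on_continuous) auto
  then have "continuous_on {0<..<1} (\<lambda>t. - (- h t))" by (rule continuous_on_minus)
  then have "continuous_on {0<..<1} h" by simp
  then have H: "H \<in> borel_measurable borel"
    unfolding H_def by (intro borel_measurable_continuous_on_indicator) auto
  define H' where "H' t = (if t = 0 then h 0 else if t = 1 then h 1 else H t)" for t
  have "H' \<in> borel_measurable borel"
    unfolding H'_def using H by (intro measurable_If measurable_const) simp_all
  from measurable_compose[OF q this] have "(\<lambda>x. H' (q x)) \<in> borel_measurable M" .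
  moreover have "h (q x) = H' (q x)" if "x \<in> space M" for x
    using q01[OF that] by (simp add: H'_def H_def)
  ultimately show ?thesis by (simp only: measurable_cong[of M "\<lambda>x. h (q x)" "\<lambda>x. H' (q x)"])
qed

lemma measure_unit_interval: "measure unit_interval (space unit_interval) = 1"
  by (simp add: measure_def emeasure_unit_interval)

lemma measure_unit_box: "finite I \<Longrightarrow> measure (unit_box I) (space (unit_box I)) = 1"
  by (simp only: measure_def emeasure_box_space) simp

lemma integral_between:
  fixes f :: "'a \<Rightarrow> real"
  assumes M: "finite_measure M" "measure M (space M) = 1" and f: "f \<in> borel_measurable M"
    and ab: "\<And>x. x \<in> space M \<Longrightarrow> a \<le> f x \<and> f x \<le> b"
  shows "a \<le> (\<integral>x. f x \<partial>M)" "(\<integral>x. f x \<partial>M) \<le> b"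
proof -
  interpret finite_measure M by (rule M(1))
  have int: "integrable M f"
  proof (rule integrable_bounded[OF M(1) f])
    show "\<bar>f x\<bar> \<le> max \<bar>a\<bar> \<bar>b\<bar>" if "x \<in> space M" for x using ab[OF that] by linarith
  qed
  have "(\<integral>x. a \<partial>M) \<le> (\<integral>x. f x \<partial>M)" "(\<integral>x. f x \<partial>M) \<le> (\<integral>x. b \<partial>M)"
    by (rule integral_mono[OF _ int] integral_mono[OF int]; simp add: ab)+
  then show "a \<le> (\<integral>x. f x \<partial>M)" "(\<integral>x. f x \<partial>M) \<le> b" by (simp_all add: M(2))
qed

lemma space_unit_box_upd:
  assumes "x \<in> space (unit_box I)" "k \<in> I" "t \<in> space unit_interval"
  shows "x(k := t) \<in> space (unit_box I)"
  using assms unfolding space_PiM by (metis PiE_fun_upd insert_absorb)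

lemma measurable_resample:
  assumes "k \<in> I"
  shows "(\<lambda>(x, t). x(k := t)) \<in> unit_box I \<Otimes>\<^sub>M unit_interval \<rightarrow>\<^sub>M unit_box I"
  using measurable_add_dim[of k I "\<lambda>_. unit_interval"] assms by (simp only: insert_absorb)

lemma measurable_fiber:
  assumes "k \<in> I" "x \<in> space (unit_box I)" "g \<in> borel_measurable (unit_box I)"
  shows "(\<lambda>t. g (x(k := t))) \<in> borel_measurable unit_interval"
proof -
  have "(\<lambda>t. (x, t)) \<in> unit_interval \<rightarrow>\<^sub>M unit_box I \<Otimes>\<^sub>M unit_interval"
    by (rule measurable_Pair1'[OF assms(2)])
  from measurable_compose[OF measurable_compose[OF this measurable_resample[OF assms(1)]] assms(3)]
  show ?thesis by simp
qed

lemma measurable_fiber_integral: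
  fixes g :: "('i \<Rightarrow> real) \<Rightarrow> real"
  assumes "k \<in> I" "g \<in> borel_measurable (unit_box I)"
  shows "(\<lambda>x. \<integral>t. g (x(k := t)) \<partial>unit_interval) \<in> borel_measurable (unit_box I)"
proof -
  have "(\<lambda>p. g (case p of (x, t) \<Rightarrow> x(k := t))) \<in> borel_measurable (unit_box I \<Otimes>\<^sub>M unit_interval)"
    by (rule measurable_compose[OF measurable_resample[OF assms(1)] assms(2)])
  then have "case_prod (\<lambda>x t. g (x(k := t))) \<in> borel_measurable (unit_box I \<Otimes>\<^sub>M unit_interval)"
    by (simp only: case_prod_beta')
  then show ?thesis
    by (rule sigma_finite_measure.borel_measurable_lebesgue_integral[OF
        finite_measure.axioms(1)[OF finite_measure_unit_interval]])
qed

lemma fiber_integral_between: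
  fixes g :: "('i \<Rightarrow> real) \<Rightarrow> real"
  assumes "k \<in> I" "g \<in> borel_measurable (unit_box I)" "x \<in> space (unit_box I)"
    and ab: "\<And>x. x \<in> space (unit_box I) \<Longrightarrow> a \<le> g x \<and> g x \<le> b"
  shows "a \<le> (\<integral>t. g (x(k := t)) \<partial>unit_interval) \<and> (\<integral>t. g (x(k := t)) \<partial>unit_interval) \<le> b"
  using integral_between[OF finite_measure_unit_interval measure_unit_interval
      measurable_fiber[OF assms(1,3,2)], of a b] ab space_unit_box_upd[OF assms(3,1)] by blast

text \<open>Replacing one coordinate by a fresh uniform one leaves the distribution of the point unchanged.\<close>
lemma integral_resample:
  fixes g :: "('i \<Rightarrow> real) \<Rightarrow> real"
  assumes I: "finite I" "k \<in> I" and g: "g \<in> borel_measurable (unit_box I)"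
    and ab: "\<And>x. x \<in> space (unit_box I) \<Longrightarrow> a \<le> g x \<and> g x \<le> b"
  shows "(\<integral>x. \<integral>t. g (x(k := t)) \<partial>unit_interval \<partial>unit_box I) = (\<integral>x. g x \<partial>unit_box I)"
proof -
  define R where "R x = (\<integral>t. g (x(k := t)) \<partial>unit_interval)" for x
  obtain J where J: "I = insert k J" "k \<notin> J"
    using I(2) by (meson mk_disjoint_insert)
  then have finJ: "finite J" using I(1) by simp
  have bound: "integrable (unit_box I) F"
    if "F \<in> borel_measurable (unit_box I)" "\<And>x. x \<in> space (unit_box I) \<Longrightarrow> a \<le> F x \<and> F x \<le> b"
    for F :: "('i \<Rightarrow> real) \<Rightarrow> real"
  proof (rule integrable_bounded[OF finite_measure_box[OF I(1)] that(1)])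
    show "\<bar>F x\<bar> \<le> max \<bar>a\<bar> \<bar>b\<bar>" if "x \<in> space (unit_box I)" for x
      using \<open>\<And>x. x \<in> space (unit_box I) \<Longrightarrow> a \<le> F x \<and> F x \<le> b\<close>[OF that] by linarith
  qed
  have int_g: "integrable (unit_box I) g" using g ab by (rule bound)
  have int_R: "integrable (unit_box I) R"
    unfolding R_def
    by (rule bound[OF measurable_fiber_integral[OF I(2) g]]) (rule fiber_integral_between[OF I(2) g _ ab])
  have R_upd: "R (x(k := s)) = R x" for x s by (simp add: R_def)
  have "(\<integral>x. R x \<partial>unit_box I) = (\<integral>x. \<integral>s. R (x(k := s)) \<partial>unit_interval \<partial>unit_box J)"
    unfolding J(1) by (rule unit.product_integral_insert[OF finJ J(2)]) (use int_R J(1) in simp)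
  also have "\<dots> = (\<integral>x. R x \<partial>unit_box J)"
    unfolding R_upd using measure_unit_interval by simp
  also have "\<dots> = (\<integral>x. g x \<partial>unit_box I)"
    unfolding J(1) R_def
    by (rule unit.product_integral_insert[OF finJ J(2), symmetric]) (use int_g J(1) in simp)
  finally show ?thesis by (simp only: R_def)
qed

text \<open>If \<open>g\<close> is the indicator of a union of cells close to the support of \<open>f\<close>, the means of \<open>g\<close> and \<open>f\<close> along a
  fiber differ on average by no more than the integral of \<open>\<bar>g - f\<bar>\<close>, and \<open>Ent_modulus\<close> turns this into
  a bound for the entropy influences.\<close>
lemma grid_approximates_influences:
  fixes f :: "('i \<Rightarrow> real) \<Rightarrow> real"
  assumes I: "finite I" and f: "f \<in> borel_measurable (unit_box I)"
    and f01: "\<And>x. x \<in> space (unit_box I) \<Longrightarrow> f x \<in> {0, 1}" and "\<delta> > 0"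
  shows "\<exists>m P. \<bar>mean (2 ^ m) I (ind P) (\<lambda>_. 0) - (\<integral>x. f x \<partial>unit_box I)\<bar> \<le> \<delta> \<and>
    (\<forall>k\<in>I. \<bar>ent_influence (2 ^ m) I P k
      - (\<integral>x. Ent (\<integral>t. f (x(k := t)) \<partial>unit_interval) \<partial>unit_box I)\<bar> \<le> \<delta>)"
proof -
  interpret finite_measure "unit_box I" by (rule finite_measure_box[OF I])
  obtain C where C: "C \<ge> 0"
    "\<And>a b. 0 \<le> a \<Longrightarrow> a \<le> 1 \<Longrightarrow> 0 \<le> b \<Longrightarrow> b \<le> 1 \<Longrightarrow> \<bar>Ent a - Ent b\<bar> \<le> \<delta> / 2 + C * \<bar>a - b\<bar>"
    using Ent_modulus[of "\<delta> / 2"] \<open>\<delta> > 0\<close> by (metis half_gt_zero)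
  \<comment> \<open>The tolerance in measure: it must bound the change of the mean and, multiplied by \<open>C\<close>, half the change of
    the entropy influences.\<close>
  define e where "e = min \<delta> (\<delta> / (2 * (C + 1)))"
  have e: "e > 0" "e \<le> \<delta>" using \<open>\<delta> > 0\<close> C(1) by (auto simp: e_def)
  have Ce: "C * e \<le> \<delta> / 2"
  proof -
    have "C * e \<le> (C + 1) * (\<delta> / (2 * (C + 1)))"
      using C(1) e by (intro mult_mono) (auto simp: e_def)
    also have "\<dots> = \<delta> / 2" using C(1) by (auto simp: divide_simps)
    finally show ?thesis .
  qed
  define A where "A = f -` {1} \<inter> space (unit_box I)"
  have A: "A \<in> sets (unit_box I)" unfolding A_def by (rule measurable_sets[OF f]) simp
  obtain m P where mP: "measure (unit_box I) ((A - grid_set I m P) \<union> (grid_set I m P - A)) < e"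
    using grid_approximation[OF I A] e(1) by (rule grid_approximableE)
  define D where "D = (A - grid_set I m P) \<union> (grid_set I m P - A)"
  have D: "D \<in> sets (unit_box I)"
    unfolding D_def using A sets_grid_set[OF I, of m P] by (intro sets.Un sets.Diff)
  define g where "g x = ind P (cells I m x)" for x
  have g: "g \<in> borel_measurable (unit_box I)"
    unfolding g_def by (rule measurable_cells[OF I])
  have f_le: "0 \<le> f x \<and> f x \<le> 1" if "x \<in> space (unit_box I)" for x using f01[OF that] by auto
  have g_le: "0 \<le> g x \<and> g x \<le> 1" for x by (simp add: g_def)
  have fg: "\<bar>g x - f x\<bar> = indicator D x" if "x \<in> space (unit_box I)" for x
    using f01[OF that] that by (auto simp: D_def A_def g_def grid_set_def)
  have d: "(\<lambda>x. \<bar>g x - f x\<bar>) \<in> borel_measurable (unit_box I)" using f g by measurable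
  have d_le: "0 \<le> \<bar>g x - f x\<bar> \<and> \<bar>g x - f x\<bar> \<le> 1" if "x \<in> space (unit_box I)" for x
    using f_le[OF that] g_le[of x] by linarith
  have int: "integrable (unit_box I) F"
    if "F \<in> borel_measurable (unit_box I)" "\<And>x. x \<in> space (unit_box I) \<Longrightarrow> 0 \<le> F x \<and> F x \<le> 1"
    for F :: "('i \<Rightarrow> real) \<Rightarrow> real"
  proof (rule integrable_bounded[OF finite_measure_box[OF I] that(1)])
    show "\<bar>F x\<bar> \<le> 1" if "x \<in> space (unit_box I)" for x
      using \<open>\<And>x. x \<in> space (unit_box I) \<Longrightarrow> 0 \<le> F x \<and> F x \<le> 1\<close>[OF that] by simp
  qed
  have "(\<integral>x. \<bar>g x - f x\<bar> \<partial>unit_box I) = (\<integral>x. indicator D x \<partial>unit_box I)"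
    by (rule Bochner_Integration.integral_cong[OF refl fg])
  also have "\<dots> = measure (unit_box I) (D \<inter> space (unit_box I))" by simp
  also have "D \<inter> space (unit_box I) = D" using sets.sets_into_space[OF D] by blast
  finally have dist: "(\<integral>x. \<bar>g x - f x\<bar> \<partial>unit_box I) \<le> e" using mP by (simp add: D_def)
  have "\<bar>mean (2 ^ m) I (ind P) (\<lambda>_. 0) - (\<integral>x. f x \<partial>unit_box I)\<bar> \<le> \<delta>"
  proof -
    have "mean (2 ^ m) I (ind P) (\<lambda>_. 0) = (\<integral>x. g x \<partial>unit_box I)"
      unfolding g_def by (rule integral_cells[OF I, symmetric])
    then have "mean (2 ^ m) I (ind P) (\<lambda>_. 0) - (\<integral>x. f x \<partial>unit_box I) = (\<integral>x. g x - f x \<partial>unit_box I)"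
      using Bochner_Integration.integral_diff[OF int[OF g g_le] int[OF f f_le]] by simp
    also have "\<bar>\<dots>\<bar> \<le> (\<integral>x. \<bar>g x - f x\<bar> \<partial>unit_box I)" by (rule integral_abs_bound)
    finally show ?thesis using dist e by linarith
  qed
  moreover have "\<bar>ent_influence (2 ^ m) I P k
      - (\<integral>x. Ent (\<integral>t. f (x(k := t)) \<partial>unit_interval) \<partial>unit_box I)\<bar> \<le> \<delta>" if k: "k \<in> I" for k
  proof -
    define qf where "qf x = (\<integral>t. f (x(k := t)) \<partial>unit_interval)" for x
    define qg where "qg x = (\<integral>t. g (x(k := t)) \<partial>unit_interval)" for x
    have qf: "qf \<in> borel_measurable (unit_box I)" and qg: "qg \<in> borel_measurable (unit_box I)"
      unfolding qf_def qg_def using measurable_fiber_integral[OF k] f g by blast+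
    have qf01: "0 \<le> qf x \<and> qf x \<le> 1" if "x \<in> space (unit_box I)" for x
      unfolding qf_def by (rule fiber_integral_between[OF k f that f_le])
    have qg01: "0 \<le> qg x \<and> qg x \<le> 1" if "x \<in> space (unit_box I)" for x
      unfolding qg_def by (rule fiber_integral_between[OF k g that g_le])
    have Ent01: "0 \<le> Ent (q x) \<and> Ent (q x) \<le> 1"
      if "\<And>x. x \<in> space (unit_box I) \<Longrightarrow> 0 \<le> q x \<and> q x \<le> 1" "x \<in> space (unit_box I)"
      for q :: "('i \<Rightarrow> real) \<Rightarrow> real" and x
      using that(1)[OF that(2)] Ent_nonneg Ent_le_1 by blast
    have Ef: "integrable (unit_box I) (\<lambda>x. Ent (qf x))"
      using borel_measurable_concave[OF concave_on_Ent qf qf01] Ent01[OF qf01] by (rule int)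
    have Eg: "integrable (unit_box I) (\<lambda>x. Ent (qg x))"
      using borel_measurable_concave[OF concave_on_Ent qg qg01] Ent01[OF qg01] by (rule int)
    have qg_eq: "qg x = avg (2 ^ m) k (ind P) (cells I m x)" for x
    proof -
      have "cells I m (x(k := t)) = (cells I m x)(k := cell m t)" for t
        using k by (simp add: cells_def fun_eq_iff)
      then show ?thesis
        using integral_cell[of "\<lambda>a. ind P ((cells I m x)(k := a))" m]
        by (simp only: qg_def g_def avg_def of_nat_power of_nat_numeral)
    qed
    have "ent_influence (2 ^ m) I P k = (\<integral>x. Ent (qg x) \<partial>unit_box I)"
      unfolding qg_eq ent_influence_def by (rule integral_cells[OF I, symmetric])
    then have "ent_influence (2 ^ m) I P k - (\<integral>x. Ent (qf x) \<partial>unit_box I)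
        = (\<integral>x. Ent (qg x) - Ent (qf x) \<partial>unit_box I)"
      using Bochner_Integration.integral_diff[OF Eg Ef] by simp
    also have "\<bar>\<dots>\<bar> \<le> (\<integral>x. \<bar>Ent (qg x) - Ent (qf x)\<bar> \<partial>unit_box I)" by (rule integral_abs_bound)
    also have "\<dots> \<le> (\<integral>x. \<delta> / 2 + C * (\<integral>t. \<bar>g (x(k := t)) - f (x(k := t))\<bar> \<partial>unit_interval) \<partial>unit_box I)"
    proof (rule integral_mono)
      show "integrable (unit_box I) (\<lambda>x. \<bar>Ent (qg x) - Ent (qf x)\<bar>)"
        using Eg Ef by (intro integrable_abs Bochner_Integration.integrable_diff)
      have "integrable (unit_box I) (\<lambda>x. \<integral>t. \<bar>g (x(k := t)) - f (x(k := t))\<bar> \<partial>unit_interval)"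
        by (rule int[OF measurable_fiber_integral[OF k d] fiber_integral_between[OF k d _ d_le]])
      then show "integrable (unit_box I)
          (\<lambda>x. \<delta> / 2 + C * (\<integral>t. \<bar>g (x(k := t)) - f (x(k := t))\<bar> \<partial>unit_interval))"
        by (intro Bochner_Integration.integrable_add integrable_mult_right integrable_const)
    next
      fix x assume x: "x \<in> space (unit_box I)"
      have intU: "integrable unit_interval (\<lambda>t. F (x(k := t)))"
        if "F \<in> borel_measurable (unit_box I)" "\<And>x. x \<in> space (unit_box I) \<Longrightarrow> 0 \<le> F x \<and> F x \<le> 1"
    for F :: "('i \<Rightarrow> real) \<Rightarrow> real"
      proof (rule integrable_bounded[OF finite_measure_unit_interval measurable_fiber[OF k x that(1)]])
        show "\<bar>F (x(k := t))\<bar> \<le> 1" if "t \<in> space unit_interval" for t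
          using \<open>\<And>x. x \<in> space (unit_box I) \<Longrightarrow> 0 \<le> F x \<and> F x \<le> 1\<close>[OF space_unit_box_upd[OF x k that]] by simp
      qed
      have "qg x - qf x = (\<integral>t. g (x(k := t)) - f (x(k := t)) \<partial>unit_interval)"
        unfolding qg_def qf_def
        by (rule Bochner_Integration.integral_diff[OF intU[OF g g_le] intU[OF f f_le], symmetric])
      also have "\<bar>\<dots>\<bar> \<le> (\<integral>t. \<bar>g (x(k := t)) - f (x(k := t))\<bar> \<partial>unit_interval)"
        by (rule integral_abs_bound)
      finally have "C * \<bar>qg x - qf x\<bar> \<le> C * (\<integral>t. \<bar>g (x(k := t)) - f (x(k := t))\<bar> \<partial>unit_interval)"
        using C(1) by (rule mult_left_mono)
      moreover have "\<bar>Ent (qg x) - Ent (qf x)\<bar> \<le> \<delta> / 2 + C * \<bar>qg x - qf x\<bar>"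
        using qg01[OF x] qf01[OF x] by (intro C(2)) auto
      ultimately show "\<bar>Ent (qg x) - Ent (qf x)\<bar>
          \<le> \<delta> / 2 + C * (\<integral>t. \<bar>g (x(k := t)) - f (x(k := t))\<bar> \<partial>unit_interval)"
        by linarith
    qed
    also have "\<dots> = \<delta> / 2 + C * (\<integral>x. \<integral>t. \<bar>g (x(k := t)) - f (x(k := t))\<bar> \<partial>unit_interval \<partial>unit_box I)"
    proof -
      have "integrable (unit_box I) (\<lambda>x. \<integral>t. \<bar>g (x(k := t)) - f (x(k := t))\<bar> \<partial>unit_interval)"
        by (rule int[OF measurable_fiber_integral[OF k d] fiber_integral_between[OF k d _ d_le]])
      then show ?thesis
        by (subst Bochner_Integration.integral_add) (simp_all add: measure_unit_box[OF I])
    qed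
    also have "\<dots> = \<delta> / 2 + C * (\<integral>x. \<bar>g x - f x\<bar> \<partial>unit_box I)"
      using integral_resample[OF I k d d_le] by simp
    also have "\<dots> \<le> \<delta> / 2 + C * e" using dist C(1) by (intro add_left_mono mult_left_mono)
    also have "\<dots> \<le> \<delta>" using Ce by simp
    finally show ?thesis unfolding qf_def .
  qed
  ultimately show ?thesis by (intro exI[of _ m] exI[of _ P]) blast
qed

lemma tendsto_log_weight:
  assumes X: "X \<longlonglongrightarrow> L" and X01: "\<And>n. 0 \<le> X n \<and> X n \<le> 1" and L: "0 \<le> L" "L \<le> 1"
  shows "(\<lambda>n. log_weight (X n)) \<longlonglongrightarrow> log_weight L"
proof (cases "L = 0")
  case False
  have "1 < 4 / (3 * L)" using L False by (simp add: field_simps)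
  moreover from this have "0 < log 2 (4 / (3 * L))" 
    by (intro zero_less_log_cancel_iff[THEN iffD2]) linarith+
  ultimately show ?thesis
    unfolding log_weight_def using False by (intro tendsto_intros X) auto
next
  case True
  define c where "c = log 2 (4 / 3 :: real)"
  have c: "0 < c" unfolding c_def by simp
  have upper: "log_weight (X n) \<le> X n / c" for n
  proof (cases "X n = 0")
    case False
    then have "0 < X n" using X01[of n] by simp
    then have "4 / 3 \<le> 4 / (3 * X n)" using X01[of n] by (simp add: field_simps)
    then have "c \<le> log 2 (4 / (3 * X n))" unfolding c_def by (intro log_mono) auto
    then show ?thesis unfolding log_weight_def using c X01[of n] by (intro divide_left_mono) auto
  qed (simp add: log_weight_def)
  have "(\<lambda>n. X n / c) \<longlonglongrightarrow> 0 / c" using X True c by (intro tendsto_divide) auto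
  then have "(\<lambda>n. X n / c) \<longlonglongrightarrow> 0" by simp
  from tendsto_sandwich[OF _ _ tendsto_const this]
  have "(\<lambda>n. log_weight (X n)) \<longlonglongrightarrow> 0"
    using upper X01 log_weight_nonneg by (simp add: eventually_sequentially)
  then show ?thesis using True by (simp add: log_weight_def)
qed

theorem entropy_influence_inequality:
  fixes f :: "('i \<Rightarrow> real) \<Rightarrow> real"
  assumes I: "finite I" and f: "f \<in> borel_measurable (unit_box I)"
    and f01: "\<And>x. x \<in> space (unit_box I) \<Longrightarrow> f x \<in> {0, 1}"
  defines "p \<equiv> \<integral>x. f x \<partial>unit_box I"
    and "J \<equiv> \<lambda>k. \<integral>x. Ent (\<integral>t. f (x(k := t)) \<partial>unit_interval) \<partial>unit_box I"
  shows "p * (1 - p) \<le> 4 / ln 2 * (\<Sum>k\<in>I. log_weight (J k))"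
proof -
  have "\<exists>m P. \<bar>mean (2 ^ m) I (ind P) (\<lambda>_. 0) - p\<bar> \<le> 1 / real (Suc n) \<and>
    (\<forall>k\<in>I. \<bar>ent_influence (2 ^ m) I P k - J k\<bar> \<le> 1 / real (Suc n))" for n
    unfolding p_def J_def by (rule grid_approximates_influences[OF I f f01]) simp_all
  then obtain m P where mP: "\<And>n. \<bar>mean (2 ^ m n) I (ind (P n)) (\<lambda>_. 0) - p\<bar> \<le> 1 / real (Suc n)"
    "\<And>n k. k \<in> I \<Longrightarrow> \<bar>ent_influence (2 ^ m n) I (P n) k - J k\<bar> \<le> 1 / real (Suc n)"
    by metis
  define p' where "p' n = mean (2 ^ m n) I (ind (P n)) (\<lambda>_. 0)" for n
  define J' where "J' n k = ent_influence (2 ^ m n) I (P n) k" for n k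
  have lim0: "(\<lambda>n. 1 / real (Suc n)) \<longlonglongrightarrow> 0" by (rule LIMSEQ_Suc[OF lim_1_over_n])
  have p': "p' \<longlonglongrightarrow> p"
    by (rule LIM_zero_cancel, rule Lim_null_comparison[OF always_eventually lim0])
      (simp only: real_norm_def p'_def mP(1) simp_thms)
  have J': "(\<lambda>n. J' n k) \<longlonglongrightarrow> J k" if "k \<in> I" for k
    by (rule LIM_zero_cancel, rule Lim_null_comparison[OF always_eventually lim0])
      (simp only: real_norm_def J'_def mP(2)[OF that] simp_thms)
  have J'01: "0 \<le> J' n k \<and> J' n k \<le> 1" for n k
    unfolding J'_def using ent_influence_01[OF I, of "2 ^ m n"] by simp
  have J01: "0 \<le> J k" "J k \<le> 1" if "k \<in> I" for k
    using LIMSEQ_le_const[OF J'[OF that], of 0] LIMSEQ_le_const2[OF J'[OF that], of 1] J'01 by blast+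
  have "(\<lambda>n. p' n * (1 - p' n)) \<longlonglongrightarrow> p * (1 - p)"
    by (intro tendsto_intros p')
  moreover have "(\<lambda>n. 4 / ln 2 * (\<Sum>k\<in>I. log_weight (J' n k))) \<longlonglongrightarrow> 4 / ln 2 * (\<Sum>k\<in>I. log_weight (J k))"
    by (intro tendsto_mult tendsto_const tendsto_sum tendsto_log_weight J' J'01 J01)
  ultimately show ?thesis
  proof (rule LIMSEQ_le)
    show "\<exists>N. \<forall>n\<ge>N. p' n * (1 - p' n) \<le> 4 / ln 2 * (\<Sum>k\<in>I. log_weight (J' n k))"
      unfolding p'_def J'_def using grid_inequality[OF I] by blast
  qed
qed

text \<open>The fiber means lie in \<open>[0,1]\<close>, so \<open>h \<ge> Ent\<close> and monotonicity of \<open>log_weight\<close> reduce the claim to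
  \<open>entropy_influence_inequality\<close>. Concavity of \<open>h\<close> makes the integrand of the \<open>h\<close>-influence
  measurable.\<close>
theorem proposition2:
  fixes h :: "real \<Rightarrow> real"
  assumes "h \<in> {0..1} \<rightarrow> {0..1}"
    and "concave_on {0..1} h"
    and "\<forall>t\<in>{0..1}. h t \<ge> Ent t"
  shows "\<exists>K>0. \<forall>n\<ge>1. \<forall>(f :: (nat \<Rightarrow> real) \<Rightarrow> real) (p :: real).
    f \<in> borel_measurable (cube n) \<longrightarrow>
    f \<in> space (cube n) \<rightarrow> {0, 1} \<longrightarrow>
    p = (\<integral>x. f x \<partial>cube n) \<longrightarrow>
    p * (1 - p) \<le> K * (\<Sum>i = 1..n.
      if h_influence n h f i = 0 then 0
      else h_influence n h f i / log 2 (4 / (3 * h_influence n h f i)))"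
proof (intro exI[of _ "4 / ln 2"] conjI allI impI)
  show "(0::real) < 4 / ln 2" by simp
next
  fix n :: nat and f :: "(nat \<Rightarrow> real) \<Rightarrow> real" and p :: real
  assume f: "f \<in> borel_measurable (cube n)" and f01: "f \<in> space (cube n) \<rightarrow> {0, 1}"
    and p: "p = (\<integral>x. f x \<partial>cube n)"
  define I where "I = {1..n}"
  have I: "finite I" by (simp add: I_def)
  have cube: "cube n = unit_box I" by (simp add: cube_def I_def)
  note f = f[unfolded cube]
  have f01: "f x \<in> {0, 1}" if "x \<in> space (unit_box I)" for x
    using f01 that unfolding cube by (rule funcset_mem)
  have f_le: "0 \<le> f x \<and> f x \<le> 1" if "x \<in> space (unit_box I)" for x using f01[OF that] by auto
  define q where "q k x = (\<integral>t. f (x(k := t)) \<partial>unit_interval)" for k x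
  define J where "J k = (\<integral>x. Ent (q k x) \<partial>unit_box I)" for k
  have h_infl: "h_influence n h f k = (\<integral>x. h (q k x) \<partial>unit_box I)" for k
    by (simp only: h_influence_def fiber_def q_def cube)
  have weight: "log_weight (J k) \<le> log_weight (h_influence n h f k)" if k: "k \<in> I" for k
  proof -
    have q: "q k \<in> borel_measurable (unit_box I)"
      unfolding q_def by (rule measurable_fiber_integral[OF k f])
    have q01: "0 \<le> q k x \<and> q k x \<le> 1" if "x \<in> space (unit_box I)" for x
      unfolding q_def by (rule fiber_integral_between[OF k f that f_le])
    have m: "(\<lambda>x. Ent (q k x)) \<in> borel_measurable (unit_box I)" "(\<lambda>x. h (q k x)) \<in> borel_measurable (unit_box I)"
      using borel_measurable_concave[OF concave_on_Ent q q01] borel_measurable_concave[OF assms(2) q q01] by blast+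
    have Ent01: "0 \<le> Ent (q k x) \<and> Ent (q k x) \<le> 1" if "x \<in> space (unit_box I)" for x
      using q01[OF that] Ent_nonneg Ent_le_1 by blast
    have h01: "0 \<le> h (q k x) \<and> h (q k x) \<le> 1" if "x \<in> space (unit_box I)" for x
      using funcset_mem[OF assms(1), of "q k x"] q01[OF that] by simp
    note fin = finite_measure_box[OF I]
    have "J k \<le> (\<integral>x. h (q k x) \<partial>unit_box I)"
      unfolding J_def
    proof (rule integral_mono)
      show "integrable (unit_box I) (\<lambda>x. Ent (q k x))"
        by (rule integrable_bounded[OF fin m(1), of 1]) (use Ent01 in simp)
      show "integrable (unit_box I) (\<lambda>x. h (q k x))"
        by (rule integrable_bounded[OF fin m(2), of 1]) (use h01 in simp)
      show "Ent (q k x) \<le> h (q k x)" if "x \<in> space (unit_box I)" for x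
        using assms(3) q01[OF that] by simp
    qed
    moreover have "0 \<le> J k"
      unfolding J_def by (rule integral_between(1)[OF fin measure_unit_box[OF I] m(1) Ent01])
    moreover have "(\<integral>x. h (q k x) \<partial>unit_box I) \<le> 1"
      by (rule integral_between(2)[OF fin measure_unit_box[OF I] m(2) h01])
    ultimately show ?thesis unfolding h_infl by (intro log_weight_mono)
  qed
  have "p * (1 - p) \<le> 4 / ln 2 * (\<Sum>k\<in>I. log_weight (J k))"
    unfolding p cube J_def q_def by (rule entropy_influence_inequality[OF I f f01])
  also have "\<dots> \<le> 4 / ln 2 * (\<Sum>k\<in>I. log_weight (h_influence n h f k))"
    using weight by (intro mult_left_mono sum_mono) auto
  also have "(\<Sum>k\<in>I. log_weight (h_influence n h f k)) = (\<Sum>i = 1..n.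
      if h_influence n h f i = 0 then 0
      else h_influence n h f i / log 2 (4 / (3 * h_influence n h f i)))"
    unfolding I_def by (intro sum.cong refl) (simp add: log_weight_def)
  finally show "p * (1 - p) \<le> 4 / ln 2 * (\<Sum>i = 1..n.
      if h_influence n h f i = 0 then 0
      else h_influence n h f i / log 2 (4 / (3 * h_influence n h f i)))" .
qed

end
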